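(* Let $\mathcal V$ be a multivector field on $X$, assume $X$ is invariant, let $\mathbb P=\{1,2,\dots,n\}$ with the usual linear order, and let $\mathcal M=\{M_p\mid p\in\mathbb P\}$ be a Morse decomposition of $X$. Set $A_i:=M(\{1,\dots,i\})$ for $i\ge1$ and $A_0:=\emptyset$. Then for each $i=1,\dots,n$, $(A_{i-1},M_i)$ is an attractor–repeller pair in $A_i$, i.e. $A_{i-1}$ is an attractor and $M_i=\operatorname{Inv}(A_i\setminus A_{i-1})$ is its dual repeller for the multivector field $\{V\in\mathcal V:V\subset A_i\}$ induced on $A_i$. Moreover, $$\sum_{i=1}^n p_{M_i}(t)=p_X(t)+(1+t)\sum_{i=1}^n q_i(t)$$ for some polynomials $q_i(t)$ with non-negative coefficients such that, for $i=2,\dots,n$, $q_i(t)\neq0$ implies $C(M_i,A_{i-1})\neq\emptyset$.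
   Context: $X$ is a finite $T_0$ topological space. For $A\subset X$, $\operatorname{cl}A$ is its closure and $\operatorname{mo}A:=\operatorname{cl}A\setminus A$. $A$ is locally closed if it is the intersection of an open and a closed subset of $X$. $H$ denotes relative singular homology. A multivector is a nonempty locally closed subset of $X$; a multivector field $\mathcal V$ on $X$ is a partition of $X$ into multivectors. For $x\in X$, $[x]$ denotes the element of $\mathcal V$ containing $x$. A multivector $V$ is critical if $H(\operatorname{cl}V,\operatorname{mo}V)\neq0$, regular otherwise. $A\subset X$ is $\mathcal V$-compatible if for every $x\in X$ either $[x]\cap A=\emptyset$ or $[x]\subset A$. Put $\Pi_{\mathcal V}(x):=[x]\cup\operatorname{cl}\{x\}$, $\Pi_{\mathcal V}(A):=\bigcup_{x\in A}\Pi_{\mathcal V}(x)$, $\Pi_{\mathcal V}^{-1}(A):=\{x:\Pi_{\mathcal V}(x)\cap A\neq\emptyset\}$. A $\mathbb Z$-interval is $\mathbb Z\cap I$ for a real interval $I$. A solution in $A\subset X$ is a map $\varphi:D\to A$ on a $\mathbb Z$-interval $D$ with $\varphi(i+1)\in\Pi_{\mathcal V}(\varphi(i))$ whenever $i,i+1\in D$; it is full if $D=\mathbb Z$, and a path if $D$ is bounded, its endpoints being $\varphi(\min D)$ and $\varphi(\max D)$. A full solution $\varphi$ is essential if for every $t\in\mathbb Z$ with $[\varphi(t)]$ regular, the set $\{s\in\mathbb Z:\varphi(s)\notin[\varphi(t)]\}$ is unbounded below and unbounded above. $\operatorname{Inv}A$ is the set of $x\in A$ such that there is an essential full solution $\varphi$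 with image in $A$ and $\varphi(0)=x$; $A$ is invariant if $\operatorname{Inv}A=A$. A closed set $N$ isolates an invariant set $S\subset N$ if (a) every path in $N$ with both endpoints in $S$ has image contained in $S$, and (b) $\Pi_{\mathcal V}(S)\subset N$. An invariant set is an isolated invariant set if some closed set isolates it. An invariant set $A$ is an attractor if $\Pi_{\mathcal V}(A)=A$, a repeller if $\Pi_{\mathcal V}^{-1}(A)=A$ (these notions are applied within $A_i$ using the induced field). For a full solution $\varphi$: $\operatorname{uim}^-\varphi:=\bigcap_{t\le0}\varphi((-\infty,t])$, $\operatorname{uim}^+\varphi:=\bigcap_{t\ge0}\varphi([t,\infty))$; the $\mathcal V$-hull $\langle A\rangle_{\mathcal V}$ is the intersection of all $\mathcal V$-compatible locally closed sets containing $A$; $\alpha(\varphi):=\langle\operatorname{uim}^-\varphi\rangle_{\mathcal V}$, $\omega(\varphi):=\langle\operatorname{uim}^+\varphi\rangle_{\mathcal V}$. For invariant $X$ and a finite poset $(\mathbb P,\le)$, a family $\mathcal M=\{M_p\mid p\in\mathbb P\}$ is a Morse decomposition of $X$ if (i) the $M_p$ are mutually disjoint isolated invariant subsets of $X$, and (ii) for every essential full solution $\varphi$ in $X$ either $\operatorname{im}\varphi\subset M_r$ for some $r$, or there exist $p<q$ with $\alpha(\varphi)\subset M_q$ and $\omega(\varphi)\subset M_p$. The connection set $C(A,B)$ is the set of $x\in X$ for which some essential full solution $\varphi$ in $X$ has $\varphi(0)=x$, $\alpha(\varphi)\subset A$, $\omega(\varphi)\subset B$; for $I\subset\mathbb P$,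 $M(I):=\bigcup_{i,j\in I}C(M_i,M_j)$. For a locally closed $A$, $\beta_i(A):=\operatorname{rank}H_i(\operatorname{cl}A,\operatorname{mo}A)$ and $p_A(t):=\sum_{i\ge0}\beta_i(A)t^i$. *)

theory Defs
  imports "HOL-Analysis.Analysis" "HOL-Homology.Homology" "HOL-Computational_Algebra.Polynomial"
begin

definition mcl :: "'a topology \<Rightarrow> 'a set \<Rightarrow> 'a set" where
  "mcl X A = X closure_of A"

definition mouth :: "'a topology \<Rightarrow> 'a set \<Rightarrow> 'a set" where
  "mouth X A = mcl X A - A"

definition loc_closed :: "'a topology \<Rightarrow> 'a set \<Rightarrow> bool" where
  "loc_closed X A \<longleftrightarrow> (\<exists>U C. openin X U \<and> closedin X C \<and> A = U \<inter> C)"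

definition int_independent :: "('g, 'm) monoid_scheme \<Rightarrow> 'g set \<Rightarrow> bool" where
  "int_independent G S \<longleftrightarrow> finite S \<and> S \<subseteq> carrier G \<and>
     (\<forall>c :: 'g \<Rightarrow> int. finprod G (\<lambda>x. x [^]\<^bsub>G\<^esub> c x) S = \<one>\<^bsub>G\<^esub> \<longrightarrow> (\<forall>x\<in>S. c x = 0))"

definition group_rank :: "('g, 'm) monoid_scheme \<Rightarrow> nat" where
  "group_rank G = Sup {card S | S. int_independent G S}"

definition betti :: "'a topology \<Rightarrow> 'a set \<Rightarrow> nat \<Rightarrow> nat" where
  "betti X A i = group_rank (relative_homology_group (int i) (subtopology X (mcl X A)) (mouth X A))"

text \<open>p_A(t) = sum_i beta_i(A) t^i (finitely supported for finite spaces).\<close>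
definition poincare :: "'a topology \<Rightarrow> 'a set \<Rightarrow> nat poly" where
  "poincare X A = Abs_poly (betti X A)"

definition multivector_field :: "'a topology \<Rightarrow> 'a set set \<Rightarrow> bool" where
  "multivector_field X V \<longleftrightarrow> \<Union>V = topspace X \<and>
     (\<forall>W\<in>V. W \<noteq> {} \<and> loc_closed X W) \<and>
     (\<forall>W1\<in>V. \<forall>W2\<in>V. W1 \<noteq> W2 \<longrightarrow> W1 \<inter> W2 = {})"

definition mvcell :: "'a set set \<Rightarrow> 'a \<Rightarrow> 'a set" where
  "mvcell V x = (THE W. W \<in> V \<and> x \<in> W)"

definition critical :: "'a topology \<Rightarrow> 'a set \<Rightarrow> bool" where
  "critical X W \<longleftrightarrow>
     (\<exists>p. \<not> trivial_group (relative_homology_group p (subtopology X (mcl X W)) (mouth X W)))"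

definition regular :: "'a topology \<Rightarrow> 'a set \<Rightarrow> bool" where
  "regular X W \<longleftrightarrow> \<not> critical X W"

definition compatible :: "'a topology \<Rightarrow> 'a set set \<Rightarrow> 'a set \<Rightarrow> bool" where
  "compatible X V A \<longleftrightarrow> (\<forall>x\<in>topspace X. mvcell V x \<inter> A = {} \<or> mvcell V x \<subseteq> A)"

definition Pi_pt :: "'a topology \<Rightarrow> 'a set set \<Rightarrow> 'a \<Rightarrow> 'a set" where
  "Pi_pt X V x = mvcell V x \<union> mcl X {x}"

definition Pi_set :: "'a topology \<Rightarrow> 'a set set \<Rightarrow> 'a set \<Rightarrow> 'a set" where
  "Pi_set X V A = (\<Union>x\<in>A. Pi_pt X V x)"

definition Pi_inv :: "'a topology \<Rightarrow> 'a set set \<Rightarrow> 'a set \<Rightarrow> 'a set" where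
  "Pi_inv X V A = {x \<in> topspace X. Pi_pt X V x \<inter> A \<noteq> {}}"

definition induced :: "'a set set \<Rightarrow> 'a set \<Rightarrow> 'a set set" where
  "induced V A = {W \<in> V. W \<subseteq> A}"

definition full_solution :: "'a topology \<Rightarrow> 'a set set \<Rightarrow> 'a set \<Rightarrow> (int \<Rightarrow> 'a) \<Rightarrow> bool" where
  "full_solution X V A \<phi> \<longleftrightarrow> (\<forall>i. \<phi> i \<in> A) \<and> (\<forall>i. \<phi> (i + 1) \<in> Pi_pt X V (\<phi> i))"

definition path_sol :: "'a topology \<Rightarrow> 'a set set \<Rightarrow> 'a set \<Rightarrow> int \<Rightarrow> int \<Rightarrow> (int \<Rightarrow> 'a) \<Rightarrow> bool" where
  "path_sol X V A a b \<phi> \<longleftrightarrow> a \<le> b \<and> (\<forall>i\<in>{a..b}. \<phi> i \<in> A) \<and>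
     (\<forall>i. a \<le> i \<and> i + 1 \<le> b \<longrightarrow> \<phi> (i + 1) \<in> Pi_pt X V (\<phi> i))"

definition essential :: "'a topology \<Rightarrow> 'a set set \<Rightarrow> (int \<Rightarrow> 'a) \<Rightarrow> bool" where
  "essential X V \<phi> \<longleftrightarrow> (\<forall>t. regular X (mvcell V (\<phi> t)) \<longrightarrow>
      ((\<forall>m. \<exists>s. s \<le> m \<and> \<phi> s \<notin> mvcell V (\<phi> t)) \<and>
       (\<forall>m. \<exists>s. s \<ge> m \<and> \<phi> s \<notin> mvcell V (\<phi> t))))"

definition ess_full_solution :: "'a topology \<Rightarrow> 'a set set \<Rightarrow> 'a set \<Rightarrow> (int \<Rightarrow> 'a) \<Rightarrow> bool" where
  "ess_full_solution X V A \<phi> \<longleftrightarrow> full_solution X V A \<phi> \<and> essential X V \<phi>"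

definition Inv :: "'a topology \<Rightarrow> 'a set set \<Rightarrow> 'a set \<Rightarrow> 'a set" where
  "Inv X V A = {x \<in> A. \<exists>\<phi>. ess_full_solution X V A \<phi> \<and> \<phi> 0 = x}"

definition invariant :: "'a topology \<Rightarrow> 'a set set \<Rightarrow> 'a set \<Rightarrow> bool" where
  "invariant X V A \<longleftrightarrow> Inv X V A = A"

definition isolates :: "'a topology \<Rightarrow> 'a set set \<Rightarrow> 'a set \<Rightarrow> 'a set \<Rightarrow> bool" where
  "isolates X V N S \<longleftrightarrow> closedin X N \<and> S \<subseteq> N \<and>
     (\<forall>a b \<phi>. path_sol X V N a b \<phi> \<and> \<phi> a \<in> S \<and> \<phi> b \<in> S \<longrightarrow> \<phi> ` {a..b} \<subseteq> S) \<and>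
     Pi_set X V S \<subseteq> N"

definition isolated_invariant :: "'a topology \<Rightarrow> 'a set set \<Rightarrow> 'a set \<Rightarrow> bool" where
  "isolated_invariant X V S \<longleftrightarrow> invariant X V S \<and> (\<exists>N. isolates X V N S)"

definition attractor :: "'a topology \<Rightarrow> 'a set set \<Rightarrow> 'a set \<Rightarrow> bool" where
  "attractor X V A \<longleftrightarrow> invariant X V A \<and> Pi_set X V A = A"

definition repeller :: "'a topology \<Rightarrow> 'a set set \<Rightarrow> 'a set \<Rightarrow> bool" where
  "repeller X V A \<longleftrightarrow> invariant X V A \<and> Pi_inv X V A = A"

definition uim_minus :: "(int \<Rightarrow> 'a) \<Rightarrow> 'a set" where
  "uim_minus \<phi> = (\<Inter>t\<in>{..0}. \<phi> ` {..t})"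

definition uim_plus :: "(int \<Rightarrow> 'a) \<Rightarrow> 'a set" where
  "uim_plus \<phi> = (\<Inter>t\<in>{0..}. \<phi> ` {t..})"

definition vhull :: "'a topology \<Rightarrow> 'a set set \<Rightarrow> 'a set \<Rightarrow> 'a set" where
  "vhull X V A = \<Inter>{B. B \<subseteq> topspace X \<and> compatible X V B \<and> loc_closed X B \<and> A \<subseteq> B}"

definition alpha_lim :: "'a topology \<Rightarrow> 'a set set \<Rightarrow> (int \<Rightarrow> 'a) \<Rightarrow> 'a set" where
  "alpha_lim X V \<phi> = vhull X V (uim_minus \<phi>)"

definition omega_lim :: "'a topology \<Rightarrow> 'a set set \<Rightarrow> (int \<Rightarrow> 'a) \<Rightarrow> 'a set" where
  "omega_lim X V \<phi> = vhull X V (uim_plus \<phi>)"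

definition morse_decomposition :: "'a topology \<Rightarrow> 'a set set \<Rightarrow> nat \<Rightarrow> (nat \<Rightarrow> 'a set) \<Rightarrow> bool" where
  "morse_decomposition X V n M \<longleftrightarrow>
     (\<forall>p\<in>{1..n}. M p \<subseteq> topspace X \<and> isolated_invariant X V (M p)) \<and>
     (\<forall>p\<in>{1..n}. \<forall>q\<in>{1..n}. p \<noteq> q \<longrightarrow> M p \<inter> M q = {}) \<and>
     (\<forall>\<phi>. ess_full_solution X V (topspace X) \<phi> \<longrightarrow>
        (\<exists>r\<in>{1..n}. range \<phi> \<subseteq> M r) \<or>
        (\<exists>p\<in>{1..n}. \<exists>q\<in>{1..n}. p < q \<and> alpha_lim X V \<phi> \<subseteq> M q \<and> omega_lim X V \<phi> \<subseteq> M p))"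

definition connection :: "'a topology \<Rightarrow> 'a set set \<Rightarrow> 'a set \<Rightarrow> 'a set \<Rightarrow> 'a set" where
  "connection X V A B = {x \<in> topspace X. \<exists>\<phi>. ess_full_solution X V (topspace X) \<phi> \<and> \<phi> 0 = x \<and>
      alpha_lim X V \<phi> \<subseteq> A \<and> omega_lim X V \<phi> \<subseteq> B}"

definition MI :: "'a topology \<Rightarrow> 'a set set \<Rightarrow> (nat \<Rightarrow> 'a set) \<Rightarrow> nat set \<Rightarrow> 'a set" where
  "MI X V M I = (\<Union>i\<in>I. \<Union>j\<in>I. connection X V (M i) (M j))"

definition Aset :: "'a topology \<Rightarrow> 'a set set \<Rightarrow> (nat \<Rightarrow> 'a set) \<Rightarrow> nat \<Rightarrow> 'a set" where
  "Aset X V M i = (if i = 0 then {} else MI X V M {1..i})"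

end

theory Submission
  imports Defs
begin

text \<open>The sets \<open>A_i\<close> are forward invariant, hence closed and compatible, because a solution through \<open>A_i\<close> can be spliced
  with any solution starting where it leads. The same splicing shows that nothing in \<open>A_i - M_i\<close> flows into
  \<open>M_i\<close>, so \<open>A_i - M_i\<close> is closed as well. Between \<open>A_{i-1}\<close> and \<open>A_i - M_i\<close> there is no essential
  solution, so the multivectors there are regular and can be stripped off one at a time without changing homology; hence
  \<open>H(A_i, A_{i-1}) = H(cl M_i, mo M_i)\<close>, and the rank count in the long exact sequences of the pairs
  \<open>(A_i, A_{i-1})\<close> telescopes to the Morse equation. If there is no connection from \<open>M_i\<close> to \<open>A_{i-1}\<close>,
  then \<open>A_i\<close> is the disjoint union of the closed sets \<open>M_i\<close> and \<open>A_{i-1}\<close>, and the connecting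
  homomorphism vanishes.

  The homological input is excision for closed subsets of a finite space. It does not follow from ordinary excision
  directly, as closed sets need not have neighbourhoods retracting onto them; a double mapping cylinder serves as a
  substitute, shown to have the right homology by Mayer-Vietoris induction over minimal open sets, in the style of
  McCord.\<close>

section \<open>Rank of abelian groups\<close>

text \<open>Ranks are suprema of cardinalities and Poincare polynomials are built by
  \<open>Abs_poly\<close>, so neither carries information until independent sets are known to be
  bounded and homology to vanish in high degrees. Finiteness of the homology of a finite space is
  therefore proved as well, again by induction over minimal open sets, which are contractible.
  Rank-nullity is formulated for subsets of an ambient group, so that kernels and images need no
  group structure of their own.

  The limit sets of the statement are hulls, which are awkward to splice. Morse sets and forward
  invariant sets are compatible and locally closed, and a hull lies in such a set exactly when the
  plain ultimate image does; ultimate images depend only on one tail of a solution.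

  Polynomials over the natural numbers make the corrections non-negative by type. All identities are
  accordingly kept additive: in each step the polynomials of \<open>M i\<close> and
  \<open>att (i - 1)\<close> add up to that of \<open>att i\<close> plus
  \<open>[:1, 1:] * q\<close>.\<close>

definition lin_comb :: "('g, 'm) monoid_scheme \<Rightarrow> ('i \<Rightarrow> 'g) \<Rightarrow> ('i \<Rightarrow> int) \<Rightarrow> 'i set \<Rightarrow> 'g" where
  "lin_comb G f c S = finprod G (\<lambda>i. f i [^]\<^bsub>G\<^esub> c i) S"

text \<open>Indexed families rather than sets: the images \<open>g x\<close> for \<open>x\<close> in
  \<open>S\<close> can then be called independent before \<open>g\<close> is known to be injective
  on \<open>S\<close>. That injectivity is a consequence, \<open>indep_family_inj\<close>.\<close>

definition indep_family :: "('g, 'm) monoid_scheme \<Rightarrow> ('i \<Rightarrow> 'g) \<Rightarrow> 'i set \<Rightarrow> bool" where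
  "indep_family G f S \<longleftrightarrow> finite S \<and> f ` S \<subseteq> carrier G \<and>
     (\<forall>c. lin_comb G f c S = \<one>\<^bsub>G\<^esub> \<longrightarrow> (\<forall>i\<in>S. c i = 0))"

lemma int_independent_iff: "int_independent G S \<longleftrightarrow> indep_family G (\<lambda>x. x) S"
  by (simp add: int_independent_def indep_family_def lin_comb_def)

context comm_group
begin

lemma lin_comb_closed [simp]:
  assumes "f ` S \<subseteq> carrier G" shows "lin_comb G f c S \<in> carrier G"
  using assms unfolding lin_comb_def by (intro finprod_closed) auto

lemma lin_comb_cong:
  assumes "f ` S \<subseteq> carrier G" "\<And>i. i \<in> S \<Longrightarrow> f i = f' i" "\<And>i. i \<in> S \<Longrightarrow> c i = c' i"
  shows "lin_comb G f c S = lin_comb G f' c' S"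
  unfolding lin_comb_def using assms by (intro finprod_cong') (auto simp: image_subset_iff)

lemma lin_comb_zero: "(\<And>i. i \<in> S \<Longrightarrow> c i = 0) \<Longrightarrow> lin_comb G f c S = \<one>"
  unfolding lin_comb_def by (intro finprod_one_eqI) auto

lemma lin_comb_add:
  assumes "f ` S \<subseteq> carrier G"
  shows "lin_comb G f c S \<otimes> lin_comb G f d S = lin_comb G f (\<lambda>i. c i + d i) S"
proof -
  have "lin_comb G f (\<lambda>i. c i + d i) S = finprod G (\<lambda>i. f i [^] c i \<otimes> f i [^] d i) S"
    unfolding lin_comb_def using assms by (intro finprod_cong') (auto simp: int_pow_mult)
  then show ?thesis
    using assms unfolding lin_comb_def by (subst (asm) finprod_multf) auto
qed

lemma lin_comb_pow:
  assumes "finite S" "f ` S \<subseteq> carrier G"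
  shows "lin_comb G f c S [^] (m::int) = lin_comb G f (\<lambda>i. c i * m) S"
  using assms
proof (induction S)
  case empty
  then show ?case by (simp add: lin_comb_def)
next
  case (insert x F)
  then have "lin_comb G f c (insert x F) = f x [^] c x \<otimes> lin_comb G f c F"
    unfolding lin_comb_def by (intro finprod_insert) auto
  moreover have "lin_comb G f (\<lambda>i. c i * m) (insert x F) = f x [^] (c x * m) \<otimes> lin_comb G f (\<lambda>i. c i * m) F"
    unfolding lin_comb_def using insert by (intro finprod_insert) auto
  ultimately show ?case
    using insert by (simp add: int_pow_distrib int_pow_pow)
qed

lemma lin_comb_insert:
  assumes "finite S" "i \<notin> S" "f ` insert i S \<subseteq> carrier G"
  shows "lin_comb G f c (insert i S) = f i [^] c i \<otimes> lin_comb G f c S"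
  using assms unfolding lin_comb_def by (intro finprod_insert) auto

lemma lin_comb_Un:
  assumes "finite S" "finite T" "S \<inter> T = {}" "f ` (S \<union> T) \<subseteq> carrier G"
  shows "lin_comb G f c (S \<union> T) = lin_comb G f c S \<otimes> lin_comb G f c T"
  using assms unfolding lin_comb_def by (intro finprod_Un_disjoint) auto

lemma lin_comb_superset:
  assumes "finite T" "S \<subseteq> T" "f ` T \<subseteq> carrier G" "\<And>i. i \<in> T - S \<Longrightarrow> c i = 0"
  shows "lin_comb G f c T = lin_comb G f c S"
proof -
  have "lin_comb G f c (S \<union> (T - S)) = lin_comb G f c S \<otimes> lin_comb G f c (T - S)"
    by (rule lin_comb_Un) (use assms finite_subset in auto)
  moreover have "lin_comb G f c (T - S) = \<one>"
    by (rule lin_comb_zero) (use assms in auto)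
  moreover have "S \<union> (T - S) = T"
    using assms by auto
  moreover have "lin_comb G f c S \<in> carrier G"
    by (rule lin_comb_closed) (use assms in auto)
  ultimately show ?thesis
    by simp
qed

lemma lin_comb_lin_comb:
  assumes "finite T" "finite S" "f ` S \<subseteq> carrier G"
  shows "lin_comb G (\<lambda>t. lin_comb G f (c t) S) e T = lin_comb G f (\<lambda>i. \<Sum>t\<in>T. c t i * e t) S"
  using assms(1)
proof (induction T)
  case empty
  then show ?case by (simp add: lin_comb_def)
next
  case (insert t T)
  then have "lin_comb G (\<lambda>t. lin_comb G f (c t) S) e (insert t T)
     = lin_comb G f (c t) S [^] e t \<otimes> lin_comb G f (\<lambda>i. \<Sum>t\<in>T. c t i * e t) S"
    using assms by (subst lin_comb_insert) auto
  also have "\<dots> = lin_comb G f (\<lambda>i. c t i * e t + (\<Sum>t\<in>T. c t i * e t)) S"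
    using assms by (simp add: lin_comb_pow lin_comb_add)
  finally show ?case
    using insert by simp
qed

text \<open>Two indices with a common value would satisfy the relation with coefficients 1 and
  -1.\<close>

lemma indep_family_inj:
  assumes "indep_family G f S" shows "inj_on f S"
proof (rule inj_onI, rule ccontr)
  fix x y assume xy: "x \<in> S" "y \<in> S" "f x = f y" "x \<noteq> y"
  have S: "finite S" "f ` S \<subseteq> carrier G"
    using assms by (auto simp: indep_family_def)
  define c :: "_ \<Rightarrow> int" where "c = (\<lambda>i. if i = x then 1 else if i = y then -1 else 0)"
  have "lin_comb G f c S = lin_comb G f c {x, y}"
    by (rule lin_comb_superset) (use S xy in \<open>auto simp: c_def\<close>)
  also have "\<dots> = f x [^] c x \<otimes> (f y [^] c y \<otimes> \<one>)"
    unfolding lin_comb_def using S xy by (subst finprod_insert) auto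
  also have "\<dots> = \<one>"
    using S xy by (auto simp: c_def int_pow_neg)
  finally have "c x = 0"
    using assms xy unfolding indep_family_def by blast
  then show False
    by (simp add: c_def)
qed

lemma lin_comb_image:
  assumes "inj_on h S" "f ` h ` S \<subseteq> carrier G"
  shows "lin_comb G f c (h ` S) = lin_comb G (\<lambda>i. f (h i)) (\<lambda>i. c (h i)) S"
  unfolding lin_comb_def using assms by (subst finprod_reindex) auto

lemma indep_family_reindex:
  assumes "inj_on h S"
  shows "indep_family G f (h ` S) \<longleftrightarrow> indep_family G (\<lambda>i. f (h i)) S"
proof (cases "finite S \<and> f ` h ` S \<subseteq> carrier G")
  case True
  then have *: "lin_comb G f c (h ` S) = lin_comb G (\<lambda>i. f (h i)) (\<lambda>i. c (h i)) S" for c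
    using assms by (intro lin_comb_image) auto
  have "lin_comb G (\<lambda>i. f (h i)) c S = lin_comb G (\<lambda>i. f (h i)) (\<lambda>i. (c \<circ> inv_into S h) (h i)) S" for c
    by (rule lin_comb_cong) (use True assms in auto)
  then have **: "lin_comb G (\<lambda>i. f (h i)) c S = lin_comb G f (c \<circ> inv_into S h) (h ` S)" for c
    using * by simp
  show ?thesis
  proof
    assume ind: "indep_family G f (h ` S)"
    show "indep_family G (\<lambda>i. f (h i)) S"
      unfolding indep_family_def
    proof (intro conjI allI impI ballI)
      fix c i assume "lin_comb G (\<lambda>i. f (h i)) c S = \<one>" "i \<in> S"
      then have "(c \<circ> inv_into S h) (h i) = 0"
        using ind ** unfolding indep_family_def by (metis imageI)
      then show "c i = 0"
        using assms \<open>i \<in> S\<close> by simp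
    qed (use True in auto)
  next
    assume ind: "indep_family G (\<lambda>i. f (h i)) S"
    show "indep_family G f (h ` S)"
      unfolding indep_family_def
    proof (intro conjI allI impI ballI)
      fix c i assume "lin_comb G f c (h ` S) = \<one>" "i \<in> h ` S"
      then show "c i = 0"
        using ind * unfolding indep_family_def by auto
    qed (use True in auto)
  qed
next
  case False
  then show ?thesis
    using assms by (auto simp: indep_family_def finite_image_iff)
qed

lemma int_independent_image:
  assumes "indep_family G f S" shows "int_independent G (f ` S)"
  unfolding int_independent_iff
  using indep_family_reindex[OF indep_family_inj[OF assms], of "\<lambda>x. x"] assms by simp

lemma indep_family_mono:
  assumes "indep_family G f S" "T \<subseteq> S" shows "indep_family G f T"
  unfolding indep_family_def
proof (intro conjI allI impI ballI)
  have "finite S" "f ` S \<subseteq> carrier G"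
    using assms by (auto simp: indep_family_def)
  then show fT: "finite T" "f ` T \<subseteq> carrier G"
    using assms(2) by (auto intro: finite_subset)
  fix c i assume c: "lin_comb G f c T = \<one>" "i \<in> T"
  \<comment> \<open>A relation on \<open>T\<close> becomes one on \<open>S\<close> when extended by
    zero coefficients.\<close>
  have "lin_comb G f (\<lambda>i. if i \<in> T then c i else 0) S = lin_comb G f (\<lambda>i. if i \<in> T then c i else 0) T"
    by (rule lin_comb_superset) (use assms in \<open>auto simp: indep_family_def\<close>)
  also have "\<dots> = lin_comb G f c T"
    by (rule lin_comb_cong) (use fT in auto)
  finally have "(if i \<in> T then c i else 0) = 0"
    using assms c unfolding indep_family_def by (metis (mono_tags, lifting) subsetD)
  then show "c i = 0"
    using c by simp
qed

end

lemma lin_comb_hom: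
  assumes "comm_group G" "comm_group H" "g \<in> hom G H" "f ` S \<subseteq> carrier G"
  shows "g (lin_comb G f c S) = lin_comb H (\<lambda>i. g (f i)) c S"
proof -
  interpret G: comm_group G by fact
  interpret H: comm_group H by fact
  interpret g: group_hom G H g
    using assms by unfold_locales
  show ?thesis
  proof (cases "finite S")
    case True
    then show ?thesis
      using assms(4)
    proof (induction S)
      case empty
      then show ?case by (simp add: lin_comb_def)
    next
      case (insert x F)
      then show ?case
        by (simp add: G.lin_comb_insert H.lin_comb_insert image_subset_iff g.hom_int_pow)
    qed
  qed (simp add: lin_comb_def)
qed

section \<open>Rank-nullity\<close>

definition rank_in :: "('g, 'm) monoid_scheme \<Rightarrow> 'g set \<Rightarrow> nat" where
  "rank_in G H = Sup {card S | S. int_independent G S \<and> S \<subseteq> H}"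

text \<open>Boundedness is carried separately, because \<open>Sup\<close> of an unbounded set of
  natural numbers does not reflect its members.\<close>

definition finite_rank_in :: "('g, 'm) monoid_scheme \<Rightarrow> 'g set \<Rightarrow> bool" where
  "finite_rank_in G H \<longleftrightarrow> (\<exists>N. \<forall>S. int_independent G S \<and> S \<subseteq> H \<longrightarrow> card S \<le> N)"

lemma group_rank_eq: "group_rank G = rank_in G (carrier G)"
  unfolding group_rank_def rank_in_def
  by (rule arg_cong[where f = Sup]) (auto simp: int_independent_def)

lemma int_independent_empty: "int_independent G {}"
  by (simp add: int_independent_def)

lemma finite_rank_in_mono: "finite_rank_in G H \<Longrightarrow> K \<subseteq> H \<Longrightarrow> finite_rank_in G K"
  unfolding finite_rank_in_def by (meson order_trans)

lemma rank_in_bdd: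
  assumes "finite_rank_in G H"
  shows "bdd_above {card S | S. int_independent G S \<and> S \<subseteq> H}"
  using assms unfolding finite_rank_in_def bdd_above_def by blast

lemma card_le_rank_in:
  assumes "finite_rank_in G H" "int_independent G S" "S \<subseteq> H"
  shows "card S \<le> rank_in G H"
  unfolding rank_in_def using assms by (intro cSup_upper rank_in_bdd) auto

lemma rank_in_le:
  assumes "\<And>S. int_independent G S \<Longrightarrow> S \<subseteq> H \<Longrightarrow> card S \<le> N"
  shows "rank_in G H \<le> N"
  unfolding rank_in_def using assms int_independent_empty[of G] by (intro cSup_least) auto

lemma rank_in_attained:
  assumes "finite_rank_in G H"
  obtains S where "int_independent G S" "S \<subseteq> H" "card S = rank_in G H"
proof -
  define R where "R = {card S | S. int_independent G S \<and> S \<subseteq> H}"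
  have "finite R" "R \<noteq> {}"
    using int_independent_empty[of G] rank_in_bdd[OF assms] unfolding R_def by (auto simp: bdd_above_nat)
  then have "rank_in G H \<in> R"
    unfolding rank_in_def R_def[symmetric] by (simp add: cSup_eq_Max Max_in)
  then show ?thesis
    using that by (auto simp: R_def)
qed

locale comm_group_hom = G: comm_group G + H: comm_group H for G (structure) and H (structure) +
  fixes g
  assumes hom: "g \<in> hom G H"
begin

sublocale group_hom G H g
  by unfold_locales (rule hom)

lemma indep_lift:
  assumes "int_independent H D" "D \<subseteq> g ` carrier G"
  obtains S where "indep_family H g S" "S \<subseteq> carrier G" "card S = card D"
proof -
  define h where "h = inv_into (carrier G) g"
  have h: "h y \<in> carrier G" "g (h y) = y" if "y \<in> D" for y
    using assms that unfolding h_def by (auto intro: inv_into_into f_inv_into_f)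
  have inj: "inj_on h D"
    by (rule inj_on_inverseI[of _ g]) (rule h)
  have "g ` (h ` D) = D"
    using h by (force simp: image_image)
  then have "indep_family H (\<lambda>x. x) (g ` (h ` D))"
    using assms by (simp add: int_independent_iff)
  moreover have "inj_on g (h ` D)"
    by (rule inj_on_inverseI[of _ h]) (use h in auto)
  ultimately have "indep_family H g (h ` D)"
    using H.indep_family_reindex by fastforce
  then show ?thesis
    using that h inj by (metis card_image image_subset_iff)
qed

text \<open>The lower half of rank-nullity. Applying \<open>g\<close> to a relation kills the part
  over \<open>K\<close>, so the coefficients on \<open>S\<close> vanish by independence of the
  images; what remains is a relation on \<open>K\<close> alone.\<close>

lemma indep_union_kernel:
  assumes K: "int_independent G K" "K \<subseteq> kernel G H g"
    and S: "indep_family H g S" "S \<subseteq> carrier G"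
  shows "int_independent G (K \<union> S)" "card (K \<union> S) = card K + card S"
proof -
  have disj: "K \<inter> S = {}"
  proof (rule ccontr)
    assume "K \<inter> S \<noteq> {}"
    then obtain x where x: "x \<in> K" "x \<in> S" by auto
    then have "indep_family H g {x}"
      using S H.indep_family_mono by blast
    moreover have "lin_comb H g (\<lambda>_. 1) {x} = \<one>\<^bsub>H\<^esub>"
      using x K by (auto simp: lin_comb_def kernel_def)
    ultimately show False
      by (auto simp: indep_family_def)
  qed
  have fin: "finite K" "finite S" "K \<subseteq> carrier G"
    using K S by (auto simp: indep_family_def int_independent_def)
  then show "card (K \<union> S) = card K + card S"
    using disj by (rule_tac card_Un_disjoint)
  show "int_independent G (K \<union> S)"
    unfolding int_independent_iff indep_family_def
  proof (intro conjI allI impI)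
    fix c assume c: "lin_comb G (\<lambda>x. x) c (K \<union> S) = \<one>"
    then have prod: "lin_comb G (\<lambda>x. x) c K \<otimes> lin_comb G (\<lambda>x. x) c S = \<one>"
      using fin disj S by (subst (asm) G.lin_comb_Un) auto
    have "lin_comb H g c K = \<one>\<^bsub>H\<^esub>"
      unfolding lin_comb_def using K by (intro H.finprod_one_eqI) (auto simp: kernel_def)
    then have "g (lin_comb G (\<lambda>x. x) c K) = \<one>\<^bsub>H\<^esub>"
      using fin hom by (subst lin_comb_hom[OF G.comm_group_axioms H.comm_group_axioms]) auto
    moreover have "g (lin_comb G (\<lambda>x. x) c K \<otimes> lin_comb G (\<lambda>x. x) c S) = \<one>\<^bsub>H\<^esub>"
      using prod by simp
    moreover have "lin_comb G (\<lambda>x. x) c K \<in> carrier G" "lin_comb G (\<lambda>x. x) c S \<in> carrier G"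
      using fin S by (auto intro!: G.lin_comb_closed)
    ultimately have "g (lin_comb G (\<lambda>x. x) c S) = \<one>\<^bsub>H\<^esub>"
      by simp
    then have "lin_comb H g c S = \<one>\<^bsub>H\<^esub>"
      using S hom by (subst (asm) lin_comb_hom[OF G.comm_group_axioms H.comm_group_axioms]) auto
    then have cS: "\<forall>i\<in>S. c i = 0"
      using S by (auto simp: indep_family_def)
    then have "lin_comb G (\<lambda>x. x) c S = \<one>"
      by (intro G.lin_comb_zero) auto
    then have "lin_comb G (\<lambda>x. x) c K = \<one>"
      using prod \<open>lin_comb G (\<lambda>x. x) c K \<in> carrier G\<close> by simp
    then have "\<forall>i\<in>K. c i = 0"
      using K by (auto simp: int_independent_iff indep_family_def)
    then show "\<forall>i\<in>K \<union> S. c i = 0"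
      using cS by auto
  qed (use fin S in auto)
qed

text \<open>The upper half of rank-nullity. A maximal part \<open>T\<close> of \<open>S\<close> with
  independent images is chosen. For \<open>t\<close> outside \<open>T\<close> the image of
  \<open>t\<close> need not be an integer combination of the images of \<open>T\<close>, but some
  nonzero multiple of it is; this yields a combination of \<open>S\<close> in the kernel. These
  combinations, one for each \<open>t\<close>, are independent and take the place of
  \<open>S - T\<close>.\<close>

lemma indep_split:
  assumes "int_independent G S"
  obtains T U where "int_independent H T" "T \<subseteq> g ` carrier G"
    "int_independent G U" "U \<subseteq> kernel G H g" "card S = card T + card U"
proof -
  have S: "finite S" "S \<subseteq> carrier G"
    using assms by (auto simp: int_independent_def)
  define F where "F = {T. T \<subseteq> S \<and> indep_family H g T}"
  have "finite F" "{} \<in> F"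
    using S by (auto simp: F_def indep_family_def)
  then obtain T where "T \<in> F" and Tmax: "\<And>T'. T' \<in> F \<Longrightarrow> T \<subseteq> T' \<Longrightarrow> T = T'"
    using finite_has_maximal[of F] by blast
  then have T: "T \<subseteq> S" "indep_family H g T" "finite T"
    using S by (auto simp: F_def intro: finite_subset)
  have ex: "\<exists>c. (\<forall>i. i \<notin> insert t T \<longrightarrow> c i = 0) \<and> c t \<noteq> 0 \<and> lin_comb G (\<lambda>x. x) c S \<in> kernel G H g"
    if t: "t \<in> S - T" for t
  proof -
    have "insert t T \<notin> F"
      using Tmax[of "insert t T"] t by blast
    then have "\<not> indep_family H g (insert t T)"
      using T t by (auto simp: F_def)
    then obtain c0 i0 where c0: "lin_comb H g c0 (insert t T) = \<one>\<^bsub>H\<^esub>" "i0 \<in> insert t T" "c0 i0 \<noteq> 0"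
      using S T t unfolding indep_family_def by auto
    define c where "c = (\<lambda>i. if i \<in> insert t T then c0 i else 0)"
    have "lin_comb H g c S = lin_comb H g c (insert t T)"
      by (rule H.lin_comb_superset) (use S T t in \<open>auto simp: c_def\<close>)
    also have "\<dots> = \<one>\<^bsub>H\<^esub>"
      unfolding c0(1)[symmetric] by (rule H.lin_comb_cong) (use S T t in \<open>auto simp: c_def\<close>)
    finally have cS: "lin_comb H g c S = \<one>\<^bsub>H\<^esub>" .
    \<comment> \<open>Otherwise the relation would live on \<open>T\<close>, whose images are
      independent, and all its coefficients would vanish.\<close>
    have "c t \<noteq> 0"
    proof
      assume ct: "c t = 0"
      then have "lin_comb H g c S = lin_comb H g c T"
        by (intro H.lin_comb_superset) (use S T t in \<open>auto simp: c_def\<close>)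
      then have "\<forall>i\<in>T. c i = 0"
        using cS T by (auto simp: indep_family_def)
      then show False
        using c0 ct by (auto simp: c_def)
    qed
    moreover have "g (lin_comb G (\<lambda>x. x) c S) = \<one>\<^bsub>H\<^esub>"
      using cS S hom by (subst lin_comb_hom[OF G.comm_group_axioms H.comm_group_axioms]) auto
    moreover have "lin_comb G (\<lambda>x. x) c S \<in> carrier G"
      using S by (intro G.lin_comb_closed) auto
    ultimately show ?thesis
      by (intro exI[of _ c]) (auto simp: kernel_def c_def)
  qed
  then obtain c where c: "\<And>t i. t \<in> S - T \<Longrightarrow> i \<notin> insert t T \<Longrightarrow> c t i = 0"
    "\<And>t. t \<in> S - T \<Longrightarrow> c t t \<noteq> (0::int)"
    "\<And>t. t \<in> S - T \<Longrightarrow> lin_comb G (\<lambda>x. x) (c t) S \<in> kernel G H g"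
    by metis
  define u where "u = (\<lambda>t. lin_comb G (\<lambda>x. x) (c t) S)"
  have ind: "indep_family G u (S - T)"
    unfolding indep_family_def
  proof (intro conjI allI impI ballI)
    fix e t assume e: "lin_comb G u e (S - T) = \<one>" and t: "t \<in> S - T"
    have "lin_comb G (\<lambda>x. x) (\<lambda>i. \<Sum>t\<in>S - T. c t i * e t) S = \<one>"
      using e S unfolding u_def by (subst (asm) G.lin_comb_lin_comb) auto
    then have "(\<Sum>t'\<in>S - T. c t' t * e t') = 0"
      using assms t by (auto simp: int_independent_iff indep_family_def)
    \<comment> \<open>Among the elements of \<open>S - T\<close>, the combination
      \<open>u t'\<close> involves only \<open>t'\<close> itself, so the coefficient matrix is
      diagonal there.\<close>
    moreover have "(\<Sum>t'\<in>S - T. c t' t * e t') = (\<Sum>t'\<in>{t}. c t' t * e t')"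
      by (rule sum.mono_neutral_right) (use t S c in auto)
    ultimately show "e t = 0"
      using c t by auto
  qed (use S c in \<open>auto simp: u_def\<close>)
  show ?thesis
  proof
    show "int_independent H (g ` T)"
      using H.int_independent_image[OF T(2)] .
    show "int_independent G (u ` (S - T))"
      using G.int_independent_image[OF ind] .
    show "u ` (S - T) \<subseteq> kernel G H g"
      using c by (auto simp: u_def)
    have "card S = card T + card (S - T)"
      using S T by (metis card_Diff_subset card_mono le_add_diff_inverse)
    then show "card S = card (g ` T) + card (u ` (S - T))"
      using H.indep_family_inj[OF T(2)] G.indep_family_inj[OF ind] by (simp add: card_image)
  qed (use T S in auto)
qed

lemma finite_rank_image:
  assumes "finite_rank_in G (carrier G)" shows "finite_rank_in H (g ` carrier G)"
proof -
  obtain N where N: "\<And>S. int_independent G S \<Longrightarrow> S \<subseteq> carrier G \<Longrightarrow> card S \<le> N"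
    using assms unfolding finite_rank_in_def by blast
  have "card D \<le> N" if D: "int_independent H D" "D \<subseteq> g ` carrier G" for D
  proof -
    obtain S where S: "indep_family H g S" "S \<subseteq> carrier G" "card S = card D"
      using indep_lift[OF D] .
    \<comment> \<open>A lifted set is independent in \<open>G\<close>: this is the case of an empty
      kernel part.\<close>
    then have "int_independent G ({} \<union> S)"
      by (intro indep_union_kernel) (auto simp: int_independent_empty)
    then show ?thesis
      using N S by fastforce
  qed
  then show ?thesis
    unfolding finite_rank_in_def by blast
qed

lemma finite_rank_extension:
  assumes "finite_rank_in G (kernel G H g)" "finite_rank_in H (carrier H)"
  shows "finite_rank_in G (carrier G)"
proof -
  obtain N1 where N1: "\<And>S. int_independent G S \<Longrightarrow> S \<subseteq> kernel G H g \<Longrightarrow> card S \<le> N1"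
    using assms unfolding finite_rank_in_def by blast
  obtain N2 where N2: "\<And>S. int_independent H S \<Longrightarrow> S \<subseteq> carrier H \<Longrightarrow> card S \<le> N2"
    using assms unfolding finite_rank_in_def by blast
  have "card S \<le> N1 + N2" if S: "int_independent G S" for S
  proof -
    obtain T U where TU: "int_independent H T" "T \<subseteq> g ` carrier G"
      "int_independent G U" "U \<subseteq> kernel G H g" "card S = card T + card U"
      using indep_split[OF S] .
    then have "card T \<le> N2" "card U \<le> N1"
      using N1 N2 by (auto simp: int_independent_def)
    then show ?thesis
      using TU by simp
  qed
  then show ?thesis
    unfolding finite_rank_in_def by blast
qed

lemma rank_nullity:
  assumes "finite_rank_in G (carrier G)"
  shows "group_rank G = rank_in G (kernel G H g) + rank_in H (g ` carrier G)"
proof (rule antisym)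
  have ker: "finite_rank_in G (kernel G H g)"
    using assms by (rule finite_rank_in_mono) (auto simp: kernel_def)
  have im: "finite_rank_in H (g ` carrier G)"
    using finite_rank_image[OF assms] .
  show "group_rank G \<le> rank_in G (kernel G H g) + rank_in H (g ` carrier G)"
    unfolding group_rank_eq
  proof (rule rank_in_le)
    fix S assume S: "int_independent G S"
    obtain T U where TU: "int_independent H T" "T \<subseteq> g ` carrier G"
      "int_independent G U" "U \<subseteq> kernel G H g" "card S = card T + card U"
      using indep_split[OF S] .
    then show "card S \<le> rank_in G (kernel G H g) + rank_in H (g ` carrier G)"
      using card_le_rank_in[OF ker, of U] card_le_rank_in[OF im, of T] by simp
  qed
  obtain K where K: "int_independent G K" "K \<subseteq> kernel G H g" "card K = rank_in G (kernel G H g)"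
    using rank_in_attained[OF ker] .
  obtain D where D: "int_independent H D" "D \<subseteq> g ` carrier G" "card D = rank_in H (g ` carrier G)"
    using rank_in_attained[OF im] .
  obtain S where S: "indep_family H g S" "S \<subseteq> carrier G" "card S = card D"
    using indep_lift[OF D(1,2)] .
  have "card (K \<union> S) \<le> rank_in G (carrier G)"
    by (rule card_le_rank_in[OF assms]) (use indep_union_kernel[OF K(1,2) S(1,2)] K S in \<open>auto simp: kernel_def\<close>)
  then show "rank_in G (kernel G H g) + rank_in H (g ` carrier G) \<le> group_rank G"
    using indep_union_kernel[OF K(1,2) S(1,2)] K D S by (simp add: group_rank_eq)
qed

end

lemma rank_in_trivial:
  assumes "comm_group G" "H \<subseteq> {\<one>\<^bsub>G\<^esub>}" shows "rank_in G H = 0" "finite_rank_in G H"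
proof -
  interpret comm_group G by fact
  have "S = {}" if "int_independent G S" "S \<subseteq> H" for S
  proof (rule ccontr)
    assume "S \<noteq> {}"
    then have S: "S = {\<one>\<^bsub>G\<^esub>}" using that assms by auto
    have "lin_comb G (\<lambda>x. x) (\<lambda>_. 1) S = \<one>\<^bsub>G\<^esub>"
      using S by (simp add: lin_comb_def)
    then show False
      using that S by (auto simp: int_independent_iff indep_family_def)
  qed
  then have *: "card S \<le> 0" if "int_independent G S" "S \<subseteq> H" for S
    using that by (metis card.empty order_refl)
  then show "rank_in G H = 0"
    using rank_in_le[of G H 0] by simp
  show "finite_rank_in G H"
    using * unfolding finite_rank_in_def by blast
qed

lemma group_rank_iso:
  assumes "comm_group G" "comm_group H" "G \<cong> H" "finite_rank_in G (carrier G)"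
  shows "group_rank G = group_rank H" "finite_rank_in H (carrier H)"
proof -
  obtain g where g: "g \<in> iso G H"
    using assms by (auto simp: is_iso_def)
  interpret G: comm_group G by fact
  interpret H: comm_group H by fact
  interpret comm_group_hom G H g
    using g by unfold_locales (auto simp: iso_def)
  have im: "g ` carrier G = carrier H" and inj: "inj_on g (carrier G)"
    using g by (auto simp: iso_def bij_betw_def)
  have "kernel G H g = {\<one>\<^bsub>G\<^esub>}"
    using inj inj_iff_trivial_ker by blast
  then show "group_rank G = group_rank H"
    using rank_nullity[OF assms(4)] im rank_in_trivial[of G "{\<one>\<^bsub>G\<^esub>}"] G.comm_group_axioms
    by (simp add: group_rank_eq)
  show "finite_rank_in H (carrier H)"
    using finite_rank_image[OF assms(4)] im by simp
qed

text \<open>Distinct integers \<open>x\<close> and \<open>y\<close> satisfy the relation with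
  coefficients \<open>y\<close> and \<open>- x\<close>, which are not both zero.\<close>

lemma finite_rank_integer_group: "finite_rank_in integer_group (carrier integer_group)"
proof -
  interpret comm_group integer_group
    by (rule abelian_integer_group)
  have "card S \<le> 1" if S: "int_independent integer_group S" for S
  proof (rule ccontr)
    assume "\<not> card S \<le> 1"
    then obtain x y where xy: "x \<in> S" "y \<in> S" "x \<noteq> y"
      by (metis One_nat_def card_le_Suc0_iff_eq int_independent_def S)
    have "indep_family integer_group (\<lambda>x. x) {x, y}"
      using S[unfolded int_independent_iff] by (rule indep_family_mono) (use xy in auto)
    moreover define c where "c = (\<lambda>i. if i = x then y else - x)"
    moreover have "lin_comb integer_group (\<lambda>x. x) c {x, y} = \<one>\<^bsub>integer_group\<^esub>"
      using xy unfolding lin_comb_def by (subst finprod_insert) (auto simp: c_def mult.commute)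
    ultimately have "c x = 0" "c y = 0"
      unfolding indep_family_def by blast+
    then show False
      using xy by (simp add: c_def)
  qed
  then show ?thesis
    unfolding finite_rank_in_def by blast
qed

section \<open>Excision for closed subsets of finite spaces\<close>

definition acyclic_pair :: "'a topology \<Rightarrow> 'a set \<Rightarrow> 'a set \<Rightarrow> bool" where
  "acyclic_pair Y A B \<longleftrightarrow> (\<forall>p. trivial_group (relative_homology_group p (subtopology Y A) B))"

text \<open>The map induced by the inclusion itself has to be bijective; abstract isomorphism of the
  groups would not allow cancelling one inclusion from a composite.\<close>

definition incl_iso :: "'a topology \<Rightarrow> 'a set \<Rightarrow> 'a set \<Rightarrow> 'a set \<Rightarrow> 'a set \<Rightarrow> bool" where
  "incl_iso Y A B A' B' \<longleftrightarrow> (\<forall>p.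
     hom_induced p (subtopology Y A) B (subtopology Y A') B' id
       \<in> iso (relative_homology_group p (subtopology Y A) B) (relative_homology_group p (subtopology Y A') B'))"

lemma incl_iso_iff_bij:
  "incl_iso Y A B A' B' \<longleftrightarrow> (\<forall>p.
     bij_betw (hom_induced p (subtopology Y A) B (subtopology Y A') B' id)
       (carrier (relative_homology_group p (subtopology Y A) B))
       (carrier (relative_homology_group p (subtopology Y A') B')))"
  by (simp add: incl_iso_def iso_def hom_induced_hom)

lemma incl_iso_imp_isomorphic:
  "incl_iso Y A B A' B' \<Longrightarrow>
     relative_homology_group p (subtopology Y A) B \<cong> relative_homology_group p (subtopology Y A') B'"
  unfolding incl_iso_def is_iso_def by blast

text \<open>Two-out-of-three for nested inclusions when the inner one is an isomorphism;
  \<open>incl_iso_comp_iff2\<close> treats the case where the outer one is.\<close>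

lemma incl_iso_comp_iff1:
  assumes "A \<subseteq> A'" "A' \<subseteq> A''" "B \<subseteq> B'" "B' \<subseteq> B''" "incl_iso Y A B A' B'"
  shows "incl_iso Y A' B' A'' B'' \<longleftrightarrow> incl_iso Y A B A'' B''"
proof -
  have "hom_induced p (subtopology Y A) B (subtopology Y A'') B'' id
      = hom_induced p (subtopology Y A') B' (subtopology Y A'') B'' id \<circ> hom_induced p (subtopology Y A) B (subtopology Y A') B' id" for p
    using assms by (subst hom_induced_compose[symmetric])
      (auto simp: continuous_map_id_subt continuous_map_in_subtopology intro: continuous_map_from_subtopology_mono)
  moreover have "bij_betw (hom_induced p (subtopology Y A) B (subtopology Y A') B' id) (carrier (relative_homology_group p (subtopology Y A) B)) (carrier (relative_homology_group p (subtopology Y A') B'))" for p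
    using assms(5) by (simp add: incl_iso_iff_bij)
  ultimately have "bij_betw (hom_induced p (subtopology Y A') B' (subtopology Y A'') B'' id) (carrier (relative_homology_group p (subtopology Y A') B')) (carrier (relative_homology_group p (subtopology Y A'') B''))
      \<longleftrightarrow> bij_betw (hom_induced p (subtopology Y A) B (subtopology Y A'') B'' id) (carrier (relative_homology_group p (subtopology Y A) B)) (carrier (relative_homology_group p (subtopology Y A'') B''))" for p
    by (simp only: bij_betw_comp_iff)
  then show ?thesis
    by (simp add: incl_iso_iff_bij)
qed

lemma incl_iso_comp_iff2:
  assumes "A \<subseteq> A'" "A' \<subseteq> A''" "B \<subseteq> B'" "B' \<subseteq> B''" "incl_iso Y A' B' A'' B''"
  shows "incl_iso Y A B A' B' \<longleftrightarrow> incl_iso Y A B A'' B''"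
proof -
  have "hom_induced p (subtopology Y A) B (subtopology Y A'') B'' id
      = hom_induced p (subtopology Y A') B' (subtopology Y A'') B'' id \<circ> hom_induced p (subtopology Y A) B (subtopology Y A') B' id" for p
    using assms by (subst hom_induced_compose[symmetric])
      (auto simp: continuous_map_id_subt continuous_map_in_subtopology intro: continuous_map_from_subtopology_mono)
  moreover have "hom_induced p (subtopology Y A) B (subtopology Y A') B' id ` carrier (relative_homology_group p (subtopology Y A) B)
      \<subseteq> carrier (relative_homology_group p (subtopology Y A') B')" for p
    by (auto simp: hom_induced_carrier)
  moreover have "bij_betw (hom_induced p (subtopology Y A') B' (subtopology Y A'') B'' id) (carrier (relative_homology_group p (subtopology Y A') B')) (carrier (relative_homology_group p (subtopology Y A'') B''))" for p
    using assms(5) by (simp add: incl_iso_iff_bij)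
  ultimately have "bij_betw (hom_induced p (subtopology Y A) B (subtopology Y A') B' id) (carrier (relative_homology_group p (subtopology Y A) B)) (carrier (relative_homology_group p (subtopology Y A') B'))
      \<longleftrightarrow> bij_betw (hom_induced p (subtopology Y A) B (subtopology Y A'') B'' id) (carrier (relative_homology_group p (subtopology Y A) B)) (carrier (relative_homology_group p (subtopology Y A'') B''))" for p
    by (simp only: bij_betw_comp_iff2)
  then show ?thesis
    by (simp add: incl_iso_iff_bij)
qed

lemma triple_exact:
  assumes "C \<subseteq> B" "B \<subseteq> A"
  shows "exact_seq ([relative_homology_group (p-1) (subtopology Y A) C, relative_homology_group (p-1) (subtopology Y B) C,
      relative_homology_group p (subtopology Y A) B, relative_homology_group p (subtopology Y A) C,
      relative_homology_group p (subtopology Y B) C],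
     [hom_induced (p-1) (subtopology Y B) C (subtopology Y A) C id, hom_relboundary p (subtopology Y A) B C,
      hom_induced p (subtopology Y A) C (subtopology Y A) B id,
      hom_induced p (subtopology Y B) C (subtopology Y A) C id])"
proof -
  have "subtopology (subtopology Y A) B = subtopology Y B"
    using assms by (simp add: subtopology_subtopology Int_absorb1)
  then show ?thesis
    using homology_exactness_triple_1[OF assms(1), of p "subtopology Y A"]
      homology_exactness_triple_2[OF assms(1), of p "subtopology Y A"]
      homology_exactness_triple_3[OF assms(1), of p "subtopology Y A"]
    by (simp del: exact_seq_end_iff add: exact_seq_end_iff)
qed

lemma triple_exact_middle:
  assumes "C \<subseteq> B" "B \<subseteq> A"
  shows "exact_seq ([relative_homology_group p (subtopology Y A) B, relative_homology_group p (subtopology Y A) C,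
      relative_homology_group p (subtopology Y B) C],
     [hom_induced p (subtopology Y A) C (subtopology Y A) B id,
      hom_induced p (subtopology Y B) C (subtopology Y A) C id])"
  using triple_exact[OF assms, of p Y] by simp

lemma triple_exact_quotient:
  assumes "C \<subseteq> B" "B \<subseteq> A"
  shows "exact_seq ([relative_homology_group (p-1) (subtopology Y B) C,
      relative_homology_group p (subtopology Y A) B, relative_homology_group p (subtopology Y A) C],
     [hom_relboundary p (subtopology Y A) B C, hom_induced p (subtopology Y A) C (subtopology Y A) B id])"
  using triple_exact[OF assms, of p Y] by (simp add: group_hom_def group_hom_axioms_def)

lemma exact_middle_trivial:
  assumes "exact_seq ([G3, G2, G1], [g, f])" "trivial_group G1" "trivial_group G3"
  shows "trivial_group G2"
proof -
  interpret f: group_hom G1 G2 f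
    using assms by (auto simp: group_hom_def group_hom_axioms_def)
  interpret g: group_hom G2 G3 g
    using assms by (auto simp: group_hom_def group_hom_axioms_def)
  have "kernel G2 G3 g = f ` carrier G1"
    using assms by auto
  moreover have "kernel G2 G3 g = carrier G2"
    using assms by (auto simp: kernel_def trivial_group_def)
  ultimately show ?thesis
    using assms by (auto simp: trivial_group_def)
qed

lemma acyclic_pair_trans:
  assumes "C \<subseteq> B" "B \<subseteq> A" "acyclic_pair Y B C" "acyclic_pair Y A B"
  shows "acyclic_pair Y A C"
  unfolding acyclic_pair_def
proof
  fix p
  show "trivial_group (relative_homology_group p (subtopology Y A) C)"
    by (rule exact_middle_trivial[OF triple_exact_middle[OF assms(1,2)]])
      (use assms(3,4) in \<open>auto simp: acyclic_pair_def\<close>)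
qed

text \<open>In the sequence of the triple the map stands between \<open>H_p(B, C)\<close> and
  \<open>H_(p-1)(B, C)\<close>, which both vanish.\<close>

lemma incl_iso_relativize:
  assumes "C \<subseteq> B" "B \<subseteq> A" "acyclic_pair Y B C"
  shows "incl_iso Y A C A B"
  unfolding incl_iso_def
proof
  fix p
  show "hom_induced p (subtopology Y A) C (subtopology Y A) B id
      \<in> iso (relative_homology_group p (subtopology Y A) C) (relative_homology_group p (subtopology Y A) B)"
    by (rule very_short_exact_sequence)
      (use triple_exact[OF assms(1,2), of p Y] assms(3) in \<open>auto simp: acyclic_pair_def\<close>)
qed

text \<open>Here the neighbours are \<open>H_(p+1)(A, B)\<close> and \<open>H_p(A, B)\<close>, which
  is why the sequence is also taken one degree higher.\<close>

lemma incl_iso_enlarge: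
  assumes "C \<subseteq> B" "B \<subseteq> A" "acyclic_pair Y A B"
  shows "incl_iso Y B C A C"
  unfolding incl_iso_def
proof
  fix p
  show "hom_induced p (subtopology Y B) C (subtopology Y A) C id
      \<in> iso (relative_homology_group p (subtopology Y B) C) (relative_homology_group p (subtopology Y A) C)"
  proof (rule very_short_exact_sequence)
    show "exact_seq ([relative_homology_group p (subtopology Y A) B, relative_homology_group p (subtopology Y A) C,
        relative_homology_group p (subtopology Y B) C, relative_homology_group (p + 1) (subtopology Y A) B],
       [hom_induced p (subtopology Y A) C (subtopology Y A) B id,
        hom_induced p (subtopology Y B) C (subtopology Y A) C id, hom_relboundary (p + 1) (subtopology Y A) B C])"
      using triple_exact_middle[OF assms(1,2), of p Y] triple_exact[OF assms(1,2), of "p + 1" Y]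
      by (simp add: group_hom_def group_hom_axioms_def)
  qed (use assms(3) in \<open>auto simp: acyclic_pair_def\<close>)
qed

lemma acyclic_pair_of_incl_iso:
  assumes "C \<subseteq> B" "B \<subseteq> A" "incl_iso Y B C A C"
  shows "acyclic_pair Y A B"
  unfolding acyclic_pair_def
proof
  fix p
  show "trivial_group (relative_homology_group p (subtopology Y A) B)"
    by (rule exact_seq_imp_triviality)
      (use triple_exact[OF assms(1,2), of p Y] assms(3) in \<open>auto simp: incl_iso_def\<close>)
qed

text \<open>The excised set is \<open>A - O2\<close>. It is closed in \<open>A\<close>, and it lies
  in \<open>A \<inter> O1\<close>, which is open in \<open>A\<close>, because \<open>O1\<close> and
  \<open>O2\<close> cover \<open>A\<close>.\<close>

lemma incl_iso_open_excision:
  assumes "openin Y O1" "openin Y O2" "A \<subseteq> topspace Y" "A \<subseteq> O1 \<union> O2"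
  shows "incl_iso Y (A \<inter> O2) (A \<inter> O1 \<inter> O2) A (A \<inter> O1)"
  unfolding incl_iso_def
proof
  fix p
  let ?Z = "subtopology Y A" and ?U = "A - O2" and ?T = "A \<inter> O1"
  have "openin ?Z (A \<inter> O2)"
    using assms(2) by (simp add: openin_subtopology_Int2)
  moreover have "topspace ?Z - A \<inter> O2 = ?U"
    using assms(3) by auto
  ultimately have "closedin ?Z ?U"
    by (metis closedin_diff closedin_topspace)
  moreover have "openin ?Z ?T"
    using assms(1) by (simp add: openin_subtopology_Int2)
  ultimately have "?Z closure_of ?U \<subseteq> ?Z interior_of ?T"
    using assms(4) by (auto simp: closure_of_closedin interior_of_openin)
  then have *: "hom_induced p (subtopology ?Z (A - ?U)) (?T - ?U) (subtopology ?Z A) ?T id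
      \<in> iso (relative_homology_group p (subtopology ?Z (A - ?U)) (?T - ?U)) (relative_homology_group p (subtopology ?Z A) ?T)"
    by (rule homology_excision_axiom) auto
  have "subtopology ?Z (A - ?U) = subtopology Y (A \<inter> O2)" "subtopology ?Z A = ?Z" "?T - ?U = A \<inter> O1 \<inter> O2"
    by (auto simp: subtopology_subtopology intro!: arg_cong[where f = "subtopology Y"])
  then show "hom_induced p (subtopology Y (A \<inter> O2)) (A \<inter> O1 \<inter> O2) (subtopology Y A) (A \<inter> O1) id
      \<in> iso (relative_homology_group p (subtopology Y (A \<inter> O2)) (A \<inter> O1 \<inter> O2)) (relative_homology_group p (subtopology Y A) (A \<inter> O1))"
    using * by simp
qed

text \<open>A Mayer-Vietoris argument in the form of excision and two-out-of-three. Excision reduces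
  both the union relative to \<open>O1\<close> and its trace on \<open>Z\<close> relative to
  \<open>Z \<inter> O1\<close> to pairs inside \<open>O2\<close>, where the hypotheses on
  \<open>O2\<close> and \<open>O1 \<inter> O2\<close> identify them. The hypothesis on
  \<open>O1\<close> then replaces \<open>O1\<close> by \<open>Z \<inter> O1\<close> as the smaller
  space.\<close>

lemma acyclic_pair_Un:
  assumes O: "openin Y O1" "openin Y O2" and Z: "Z \<subseteq> topspace Y"
    and ac: "acyclic_pair Y O1 (Z \<inter> O1)" "acyclic_pair Y O2 (Z \<inter> O2)"
      "acyclic_pair Y (O1 \<inter> O2) (Z \<inter> (O1 \<inter> O2))"
  shows "acyclic_pair Y (O1 \<union> O2) (Z \<inter> (O1 \<union> O2))"
proof -
  let ?A = "O1 \<union> O2" and ?Z = "Z \<inter> (O1 \<union> O2)"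
  have sub: "?A \<subseteq> topspace Y" "?Z \<subseteq> topspace Y"
    using O Z openin_subset by blast+
  have "incl_iso Y (Z \<inter> O2) (Z \<inter> (O1 \<inter> O2)) O2 (Z \<inter> (O1 \<inter> O2))"
    by (rule incl_iso_enlarge) (use ac in auto)
  moreover have "incl_iso Y O2 (Z \<inter> (O1 \<inter> O2)) O2 (O1 \<inter> O2)"
    by (rule incl_iso_relativize) (use ac in auto)
  ultimately have "incl_iso Y (Z \<inter> O2) (Z \<inter> (O1 \<inter> O2)) O2 (O1 \<inter> O2)"
    by (subst (asm) incl_iso_comp_iff1) auto
  moreover have "incl_iso Y O2 (O1 \<inter> O2) ?A O1"
    using incl_iso_open_excision[OF O sub(1)] by (simp add: Int_absorb1 Int_absorb2 inf_sup_absorb Int_Un_distrib2 inf_assoc)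
  ultimately have "incl_iso Y (Z \<inter> O2) (Z \<inter> (O1 \<inter> O2)) ?A O1"
    by (subst (asm) incl_iso_comp_iff2) auto
  moreover have "incl_iso Y (Z \<inter> O2) (Z \<inter> (O1 \<inter> O2)) ?Z (Z \<inter> O1)"
  proof -
    have "?Z \<inter> O2 = Z \<inter> O2" "?Z \<inter> O1 \<inter> O2 = Z \<inter> (O1 \<inter> O2)" "?Z \<inter> O1 = Z \<inter> O1"
      by auto
    then show ?thesis
      using incl_iso_open_excision[OF O sub(2)] by simp
  qed
  \<comment> \<open>The inclusion of the pair in \<open>Z \<inter> O2\<close> into the whole union
    factors through the trace on \<open>Z\<close>; its first factor is the excision just shown and
    is cancelled.\<close>
  ultimately have "incl_iso Y ?Z (Z \<inter> O1) ?A O1"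
    by (subst (asm) incl_iso_comp_iff1[symmetric, of _ ?Z _ _ "Z \<inter> O1"]) auto
  moreover have "incl_iso Y ?A (Z \<inter> O1) ?A O1"
    by (rule incl_iso_relativize) (use ac in auto)
  ultimately have "incl_iso Y ?Z (Z \<inter> O1) ?A (Z \<inter> O1)"
    by (subst (asm) incl_iso_comp_iff2[symmetric, of _ ?A _ _ "Z \<inter> O1"]) auto
  then show ?thesis
    by (rule acyclic_pair_of_incl_iso[rotated 2]) auto
qed

section \<open>Minimal open sets and the passage from local to global\<close>

definition min_open :: "'a topology \<Rightarrow> 'a \<Rightarrow> 'a set" where
  "min_open X x = \<Inter>{U. openin X U \<and> x \<in> U}"

lemma openin_min_open:
  assumes "finite (topspace X)" "x \<in> topspace X" shows "openin X (min_open X x)"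
  unfolding min_open_def
proof (rule openin_Inter)
  have "{U. openin X U \<and> x \<in> U} \<subseteq> Pow (topspace X)"
    using openin_subset by auto
  then show "finite {U. openin X U \<and> x \<in> U}"
    using assms finite_subset by blast
qed (use assms in auto)

lemma in_min_open: "x \<in> min_open X x"
  by (auto simp: min_open_def)

lemma min_open_subset: "openin X U \<Longrightarrow> x \<in> U \<Longrightarrow> min_open X x \<subseteq> U"
  by (auto simp: min_open_def)

text \<open>To a maximal proper open subset \<open>U\<close> of \<open>W\<close> one adjoins the
  minimal open neighbourhood \<open>V\<close> of a point of \<open>W\<close> outside
  \<open>U\<close>; by maximality the union is \<open>W\<close>. As \<open>U\<close> and
  \<open>U \<inter> V\<close> are properly smaller than \<open>W\<close>, the induction covers them,
  and \<open>V\<close> itself is a base case.\<close>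

lemma finite_space_open_induct [consumes 2, case_names empty min Un]:
  assumes fin: "finite (topspace X)" and W: "openin X W"
    and empty: "P {}" and min: "\<And>x. x \<in> topspace X \<Longrightarrow> P (min_open X x)"
    and Un: "\<And>U V. openin X U \<Longrightarrow> openin X V \<Longrightarrow> P U \<Longrightarrow> P V \<Longrightarrow> P (U \<inter> V) \<Longrightarrow> P (U \<union> V)"
  shows "P W"
proof -
  have "finite W"
    using finite_subset[OF openin_subset[OF W] fin] .
  then show ?thesis
    using W
  proof (induction W rule: finite_psubset_induct)
    case (psubset W)
    show ?case
    proof (cases "W = {}")
      case False
      define F where "F = {U. openin X U \<and> U \<subset> W}"
      have "finite F"
        by (rule finite_subset[of _ "Pow W"]) (use psubset in \<open>auto simp: F_def\<close>)
      moreover have "{} \<in> F"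
        using False by (auto simp: F_def)
      ultimately obtain U where "U \<in> F" and Umax: "\<And>U'. U' \<in> F \<Longrightarrow> U \<subseteq> U' \<Longrightarrow> U = U'"
        using finite_has_maximal[of F] by blast
      then have U: "openin X U" "U \<subset> W"
        by (auto simp: F_def)
      then obtain y where y: "y \<in> W" "y \<notin> U"
        by auto
      then have yX: "y \<in> topspace X"
        using psubset openin_subset by blast
      let ?V = "min_open X y"
      have V: "openin X ?V" "?V \<subseteq> W" "y \<in> ?V"
        using openin_min_open[OF fin yX] min_open_subset[OF psubset.prems y(1)] in_min_open by auto
      have "U \<union> ?V \<notin> F"
        using Umax[of "U \<union> ?V"] y V by auto
      then have UV: "U \<union> ?V = W"
        using U V by (auto simp: F_def)
      have "P U" "P (U \<inter> ?V)"
        using psubset.IH U V y by (auto intro!: psubset.IH)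
      then show ?thesis
        using Un[OF U(1) V(1)] min[OF yX] UV by simp
    qed (use empty in simp)
  qed
qed

text \<open>The induction runs over the open sets of the finite base and concerns their preimages;
  \<open>acyclic_pair_Un\<close> is its union step.\<close>

lemma acyclic_pair_locally:
  assumes fin: "finite (topspace X)" and \<pi>: "continuous_map Y X \<pi>" and Z: "Z \<subseteq> topspace Y"
    and loc: "\<And>x. x \<in> topspace X \<Longrightarrow>
      acyclic_pair Y {y \<in> topspace Y. \<pi> y \<in> min_open X x} (Z \<inter> {y \<in> topspace Y. \<pi> y \<in> min_open X x})"
  shows "acyclic_pair Y (topspace Y) Z"
proof -
  let ?P = "\<lambda>W. {y \<in> topspace Y. \<pi> y \<in> W}"
  have "acyclic_pair Y (?P (topspace X)) (Z \<inter> ?P (topspace X))"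
  proof (rule finite_space_open_induct[OF fin openin_topspace, of "\<lambda>W. acyclic_pair Y (?P W) (Z \<inter> ?P W)"])
    show "acyclic_pair Y (?P {}) (Z \<inter> ?P {})"
      by (simp add: acyclic_pair_def trivial_relative_homology_group_empty)
  next
    fix U V assume UV: "openin X U" "openin X V" "acyclic_pair Y (?P U) (Z \<inter> ?P U)"
      "acyclic_pair Y (?P V) (Z \<inter> ?P V)" "acyclic_pair Y (?P (U \<inter> V)) (Z \<inter> ?P (U \<inter> V))"
    then have "openin Y (?P U)" "openin Y (?P V)"
      using \<pi> by (auto intro: openin_continuous_map_preimage)
    moreover have "?P (U \<union> V) = ?P U \<union> ?P V" "?P (U \<inter> V) = ?P U \<inter> ?P V"
      by auto
    ultimately show "acyclic_pair Y (?P (U \<union> V)) (Z \<inter> ?P (U \<union> V))"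
      using acyclic_pair_Un[of Y "?P U" "?P V" Z] UV Z by simp
  qed (rule loc)
  moreover have "?P (topspace X) = topspace Y"
    using \<pi> by (auto simp: continuous_map_def)
  ultimately show ?thesis
    using Z by (simp add: Int_absorb2)
qed

section \<open>Two kinds of homotopy: slides along the real line and jumps\<close>

text \<open>The straight-line homotopy towards level \<open>c\<close>. The hypothesis
  \<open>slide\<close> says that every fibre of \<open>W\<close> over \<open>X\<close> is
  star-shaped about \<open>c\<close>; \<open>P\<close> is meant to express that a subspace is
  preserved throughout.\<close>

lemma homotopic_with_slide:
  fixes c :: real
  assumes W: "W \<subseteq> topspace X \<times> UNIV"
    and slide: "\<And>x s t. (x, s) \<in> W \<Longrightarrow> 0 \<le> t \<Longrightarrow> t \<le> 1 \<Longrightarrow> (x, c + t * (s - c)) \<in> W"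
    and P: "\<And>t. 0 \<le> t \<Longrightarrow> t \<le> 1 \<Longrightarrow> P (\<lambda>z. (fst z, c + t * (snd z - c)))"
  shows "homotopic_with P (subtopology (prod_topology X euclideanreal) W) (subtopology (prod_topology X euclideanreal) W)
           (\<lambda>z. (fst z, c)) id"
  unfolding homotopic_with_def
proof (intro exI[of _ "\<lambda>z. (fst (snd z), c + fst z * (snd (snd z) - c))"] conjI allI ballI)
  let ?W = "subtopology (prod_topology X euclideanreal) W"
  let ?T = "prod_topology (top_of_set {0..1::real}) ?W"
  have "continuous_map ?T ?W snd"
    by (rule continuous_map_snd)
  then have fs: "continuous_map ?T X (\<lambda>z. fst (snd z))" and ss: "continuous_map ?T euclideanreal (\<lambda>z. snd (snd z))"
    using continuous_map_compose[of ?T ?W snd X fst] continuous_map_compose[of ?T ?W snd euclideanreal snd]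
    by (auto simp: o_def intro: continuous_map_subtopology_fst continuous_map_subtopology_snd)
  have f: "continuous_map ?T euclideanreal fst"
    using continuous_map_fst[of "top_of_set {0..1::real}" ?W] continuous_map_in_subtopology by blast
  have "continuous_map ?T (prod_topology X euclideanreal) (\<lambda>z. (fst (snd z), c + fst z * (snd (snd z) - c)))"
    by (intro continuous_intros continuous_map_pairedI fs ss f)
      (auto intro!: continuous_map_add continuous_map_real_mult continuous_map_diff f ss)
  then show "continuous_map ?T ?W (\<lambda>z. (fst (snd z), c + fst z * (snd (snd z) - c)))"
    by (rule continuous_map_into_subtopology) (auto intro: slide)
qed (use P in auto)

text \<open>The homotopy is \<open>f\<close> at all times before 1 and \<open>g\<close> at time 1.
  By \<open>gen\<close>, the preimage of an open set is the union of [0,1) times its preimage under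
  \<open>f\<close> and [0,1] times its preimage under \<open>g\<close>, which is open.\<close>

lemma homotopic_with_jump:
  assumes f: "continuous_map T Y f" and g: "continuous_map T Y g"
    and gen: "\<And>U t. openin Y U \<Longrightarrow> t \<in> topspace T \<Longrightarrow> g t \<in> U \<Longrightarrow> f t \<in> U"
    and P: "P f" "P g"
  shows "homotopic_with P T Y f g"
  unfolding homotopic_with_def
proof (intro exI[of _ "\<lambda>z. if fst z < 1 then f (snd z) else g (snd z)"] conjI allI ballI)
  let ?I = "top_of_set {0..1::real}"
  let ?h = "\<lambda>z. if fst z < (1::real) then f (snd z) else g (snd z)"
  show "continuous_map (prod_topology ?I T) Y ?h"
    unfolding continuous_map_def
  proof (intro conjI allI impI)
    show "?h \<in> topspace (prod_topology ?I T) \<rightarrow> topspace Y"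
      using f g by (auto simp: continuous_map_def)
    fix U assume U: "openin Y U"
    have "{z \<in> topspace (prod_topology ?I T). ?h z \<in> U}
        = {0..<1} \<times> {t \<in> topspace T. f t \<in> U} \<union> {0..1} \<times> {t \<in> topspace T. g t \<in> U}"
      using gen[OF U] by auto
    moreover have "openin ?I {0..<1}"
    proof -
      have "{0..<1} = {0..1} \<inter> {..<1::real}"
        by auto
      then show ?thesis
        by (simp add: openin_subtopology_Int2)
    qed
    moreover have "openin ?I {0..1}"
      using openin_topspace[of ?I] by simp
    moreover have "openin T {t \<in> topspace T. f t \<in> U}" "openin T {t \<in> topspace T. g t \<in> U}"
      using f g U by (auto intro: openin_continuous_map_preimage)
    ultimately show "openin (prod_topology ?I T) {z \<in> topspace (prod_topology ?I T). ?h z \<in> U}"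
      by (auto intro!: openin_Un simp: openin_prod_Times_iff)
  qed
next
  fix t :: real assume "t \<in> {0..1}"
  then show "P (\<lambda>x. if fst (t, x) < 1 then f (snd (t, x)) else g (snd (t, x)))"
    using P by (cases "t < 1") auto
qed auto

text \<open>The identity jumps to the constant map at \<open>x\<close>: an open subset of the
  minimal neighbourhood that contains \<open>x\<close> is all of it.\<close>

lemma contractible_min_open:
  assumes "x \<in> topspace X"
  shows "contractible_space (subtopology X (min_open X x))"
  unfolding contractible_space_def
proof (intro exI[of _ x] homotopic_with_jump)
  show "continuous_map (subtopology X (min_open X x)) (subtopology X (min_open X x)) (\<lambda>y. x)"
    using assms in_min_open[of x X] by auto
  fix U y assume U: "openin (subtopology X (min_open X x)) U" "x \<in> U"
    and y: "y \<in> topspace (subtopology X (min_open X x))"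
  then obtain O' where "openin X O'" "U = O' \<inter> min_open X x"
    by (auto simp: openin_subtopology)
  then show "id y \<in> U"
    using U y min_open_subset[of X O' x] by auto
qed auto

text \<open>The slide to level \<open>c\<close> is homotopic to the identity through maps preserving
  \<open>S\<close>, and its end map carries \<open>W\<close> into \<open>S\<close>.\<close>

lemma acyclic_pair_slide:
  fixes c :: real
  assumes W: "W \<subseteq> topspace X \<times> UNIV" "S \<subseteq> W"
    and slide: "\<And>x s t. (x, s) \<in> W \<Longrightarrow> 0 \<le> t \<Longrightarrow> t \<le> 1 \<Longrightarrow> (x, c + t * (s - c)) \<in> W"
    and slideS: "\<And>x s t. (x, s) \<in> S \<Longrightarrow> 0 \<le> t \<Longrightarrow> t \<le> 1 \<Longrightarrow> (x, c + t * (s - c)) \<in> S"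
    and end_in: "\<And>x s. (x, s) \<in> W \<Longrightarrow> (x, c) \<in> S"
  shows "acyclic_pair (prod_topology X euclideanreal) W S"
  unfolding acyclic_pair_def
proof (intro allI trivial_relative_homology_group_alt[where f = "\<lambda>z. (fst z, c)"])
  let ?W = "subtopology (prod_topology X euclideanreal) W"
  show h: "homotopic_with (\<lambda>k. k ` S \<subseteq> S) ?W ?W (\<lambda>z. (fst z, c)) id"
    by (rule homotopic_with_slide[OF W(1) slide]) (use slideS in auto)
  show "continuous_map ?W (subtopology ?W S) (\<lambda>z. (fst z, c))"
    using homotopic_with_imp_continuous_maps[OF h] end_in W(2)
    by (auto intro!: continuous_map_into_subtopology)
qed

text \<open>The projection and the section at level \<open>c\<close> are homotopy inverse to each
  other, the slide being the homotopy upstairs.\<close>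

lemma relative_homology_prod_real:
  fixes c :: real
  assumes W: "W \<subseteq> topspace X \<times> UNIV" "S \<subseteq> W"
    and slide: "\<And>x s t. (x, s) \<in> W \<Longrightarrow> 0 \<le> t \<Longrightarrow> t \<le> 1 \<Longrightarrow> (x, c + t * (s - c)) \<in> W"
    and slideS: "\<And>x s t. (x, s) \<in> S \<Longrightarrow> 0 \<le> t \<Longrightarrow> t \<le> 1 \<Longrightarrow> (x, c + t * (s - c)) \<in> S"
  shows "relative_homology_group p (subtopology (prod_topology X euclideanreal) W) S
       \<cong> relative_homology_group p (subtopology X (fst ` W)) (fst ` S)"
proof (rule homotopy_equivalent_space_imp_isomorphic_relative_homology_groups[where f = fst and g = "\<lambda>x. (x, c)"])
  let ?W = "subtopology (prod_topology X euclideanreal) W"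
  have c: "(x, c) \<in> W" if "(x, s) \<in> W" for x s
    using slide[OF that, of 0] by simp
  have cS: "(x, c) \<in> S" if "(x, s) \<in> S" for x s
    using slideS[OF that, of 0] by simp
  show "continuous_map ?W (subtopology X (fst ` W)) fst"
    by (intro continuous_map_into_subtopology continuous_map_subtopology_fst) auto
  show "continuous_map (subtopology X (fst ` W)) ?W (\<lambda>x. (x, c))"
    by (intro continuous_map_into_subtopology continuous_map_pairedI) (use c in auto)
  show "fst \<in> S \<rightarrow> fst ` S"
    by auto
  show "(\<lambda>x. (x, c)) \<in> fst ` S \<rightarrow> S"
    using cS by auto
  show "homotopic_with (\<lambda>h. h \<in> S \<rightarrow> S) ?W ?W ((\<lambda>x. (x, c)) \<circ> fst) id"
    unfolding o_def by (rule homotopic_with_slide[OF W(1) slide]) (use slideS in auto)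
  show "homotopic_with (\<lambda>k. k \<in> fst ` S \<rightarrow> fst ` S) (subtopology X (fst ` W)) (subtopology X (fst ` W)) (fst \<circ> (\<lambda>x. (x, c))) id"
    by (rule homotopic_with_equal) (auto simp: Pi_iff o_def)
qed

lemma convex_comb_bounds:
  fixes c s t :: real
  assumes "0 \<le> t" "t \<le> 1"
  shows "c < u \<Longrightarrow> s < u \<Longrightarrow> c + t * (s - c) < u" "u < c \<Longrightarrow> u < s \<Longrightarrow> u < c + t * (s - c)"
    "c \<le> u \<Longrightarrow> s \<le> u \<Longrightarrow> c + t * (s - c) \<le> u" "u \<le> c \<Longrightarrow> u \<le> s \<Longrightarrow> u \<le> c + t * (s - c)"
proof -
  have eq: "c + t * (s - c) = (1 - t) * c + t * s"
    by (simp add: algebra_simps)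
  show "c \<le> u \<Longrightarrow> s \<le> u \<Longrightarrow> c + t * (s - c) \<le> u" "u \<le> c \<Longrightarrow> u \<le> s \<Longrightarrow> u \<le> c + t * (s - c)"
    using convex_bound_le[of c u s "1 - t" t] convex_bound_le[of "-c" "-u" "-s" "1 - t" t] assms
    by (auto simp: eq)
  show "c < u \<Longrightarrow> s < u \<Longrightarrow> c + t * (s - c) < u" "u < c \<Longrightarrow> u < s \<Longrightarrow> u < c + t * (s - c)"
    using convex_bound_lt[of c u s "1 - t" t] convex_bound_lt[of "-c" "-u" "-s" "1 - t" t] assms
    by (auto simp: eq)
qed

text \<open>The double mapping cylinder of \<open>A \<inter> B\<close> in \<open>A\<close> and \<open>B\<close> carries the homology of \<open>A \<union> B\<close>, and in it the
  part above 0 is an open thickening of \<open>B\<close>, to which ordinary excision applies.\<close>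

lemma acyclic_pair_double_cylinder:
  assumes fin: "finite (topspace X)" and A: "closedin X A" and B: "closedin X B" and AB: "A \<union> B = topspace X"
  shows "acyclic_pair (prod_topology X euclideanreal) (topspace (prod_topology X euclideanreal))
    {(x, s). x \<in> topspace X \<and> (s < 1 \<longrightarrow> x \<in> A) \<and> (s > 0 \<longrightarrow> x \<in> B)}"
    (is "acyclic_pair ?Y _ ?Z")
proof (rule acyclic_pair_locally[OF fin continuous_map_fst])
  show "?Z \<subseteq> topspace ?Y"
    by auto
  fix x assume x: "x \<in> topspace X"
  let ?U = "min_open X x"
  let ?W = "{y \<in> topspace ?Y. fst y \<in> ?U}"
  have U: "?U \<subseteq> topspace X"
    using openin_min_open[OF fin x] openin_subset by blast
  have disj: "?U \<inter> C = {}" if "closedin X C" "x \<notin> C" for C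
    using min_open_subset[of X "topspace X - C" x] that x by auto
  show "acyclic_pair ?Y ?W (?Z \<inter> ?W)"
  proof (cases "x \<in> A \<inter> B")
    case True
    \<comment> \<open>The whole line over such an \<open>x\<close> lies in \<open>?Z\<close>, so
      replacing the first coordinate by \<open>x\<close> moves everything over \<open>?U\<close>
      into \<open>?Z\<close>. By minimality of \<open>?U\<close> this is a jump.\<close>
    let ?S = "subtopology ?Y ?W"
    let ?f = "\<lambda>z. (x, snd z)"
    have f: "continuous_map ?S ?S ?f"
      by (intro continuous_map_into_subtopology continuous_map_pairedI continuous_map_subtopology_snd)
        (use x in_min_open[of x X] in auto)
    have inZ: "?f z \<in> ?Z \<inter> ?W" if "z \<in> ?W" for z
      using True x in_min_open[of x X] by auto
    have "homotopic_with (\<lambda>k. k ` (?Z \<inter> ?W) \<subseteq> ?Z \<inter> ?W) ?S ?S id ?f"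
    proof (rule homotopic_with_jump)
      fix O1 z assume O1: "openin ?S O1" and z: "z \<in> topspace ?S" and fz: "?f z \<in> O1"
      obtain O2 where O2: "openin ?Y O2" "O1 = O2 \<inter> ?W"
        using O1 by (auto simp: openin_subtopology)
      then have "(x, snd z) \<in> O2"
        using fz by auto
      then obtain U1 V1 where UV: "openin X U1" "x \<in> U1" "snd z \<in> V1" "U1 \<times> V1 \<subseteq> O2"
        using O2(1) unfolding openin_prod_topology_alt by metis
      have "fst z \<in> U1"
        using min_open_subset[OF UV(1,2)] z by auto
      then have "z \<in> O2"
        using UV by (metis SigmaI prod.collapse subsetD)
      then show "id z \<in> O1"
        using O2 z by auto
    qed (use f inZ in auto)
    then have "homotopic_with (\<lambda>k. k ` (?Z \<inter> ?W) \<subseteq> ?Z \<inter> ?W) ?S ?S ?f id"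
      by (rule homotopic_with_symD)
    moreover have "continuous_map ?S (subtopology ?S (?Z \<inter> ?W)) ?f"
      by (rule continuous_map_into_subtopology[OF f]) (use inZ in \<open>simp only: topspace_subtopology Pi_iff Int_iff ball_simps\<close>, blast)
    ultimately show ?thesis
      unfolding acyclic_pair_def by (blast intro: trivial_relative_homology_group_alt)
  next
    case False
    then consider "x \<notin> B" | "x \<notin> A" by blast
    then show ?thesis
    proof cases
      case 1
      \<comment> \<open>A closed set that misses \<open>x\<close> misses \<open>?U\<close>, so over
        \<open>?U\<close> exactly the levels up to 0 belong to \<open>?Z\<close>, and a slide to
        level 0 ends there. The other case is symmetric with the levels from 1 on.\<close>
      then have "?U \<inter> B = {}" "?U \<subseteq> A"
        using disj[OF B] U AB by auto
      then have ZW: "?Z \<inter> ?W = ?U \<times> {..0}"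
        using U by auto
      show ?thesis
        unfolding ZW by (rule acyclic_pair_slide[of _ _ _ 0]) (use U convex_comb_bounds(3)[of _ 0 0] in auto)
    next
      case 2
      then have "?U \<inter> A = {}" "?U \<subseteq> B"
        using disj[OF A] U AB by auto
      then have ZW: "?Z \<inter> ?W = ?U \<times> {1..}"
        using U by auto
      show ?thesis
        unfolding ZW by (rule acyclic_pair_slide[of _ _ _ 1]) (use U convex_comb_bounds(4)[of _ 1 1] in auto)
    qed
  qed
qed

text \<open>The pair \<open>(A, A \<inter> B)\<close> is carried to \<open>(X, B)\<close> through
  \<open>(Z \<inter> Lo, D)\<close>, \<open>(Z \<inter> Lo, Z \<inter> Lo \<inter> Hi)\<close>,
  \<open>(Z, Z \<inter> Hi)\<close>, \<open>(Y, Z \<inter> Hi)\<close> and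
  \<open>(Y, B \<times> UNIV)\<close>. The passage from the second of these to the third is ordinary
  open excision; the one after it is the acyclicity of the cylinder in \<open>Y\<close>; all others
  are slides.\<close>

lemma closed_excision_topspace:
  assumes fin: "finite (topspace X)" and A: "closedin X A" and B: "closedin X B" and AB: "A \<union> B = topspace X"
  shows "relative_homology_group p (subtopology X A) (A \<inter> B) \<cong> relative_homology_group p X B"
proof -
  define Y where "Y = prod_topology X euclideanreal"
  have topY: "topspace Y = topspace X \<times> UNIV"
    by (simp add: Y_def)
  define Z where "Z = {(x, s::real). x \<in> topspace X \<and> (s < 1 \<longrightarrow> x \<in> A) \<and> (s > 0 \<longrightarrow> x \<in> B)}"
  define Lo where "Lo = topspace X \<times> {..<1::real}"
  define Hi where "Hi = topspace X \<times> {0::real<..}"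
  \<comment> \<open>The overlap \<open>Z \<inter> Lo \<inter> Hi\<close> is the product of
    \<open>A \<inter> B\<close> with the open interval from 0 to 1 and is not stable under sliding
    to level 0. \<open>D\<close> prolongs it to all levels below 1 and is stable.\<close>
  define D where "D = (A \<inter> B) \<times> {..<1::real}"
  note defs = Z_def Lo_def Hi_def D_def
  have sub: "A \<subseteq> topspace X" "B \<subseteq> topspace X"
    using A B closedin_subset by auto
  have "A \<subseteq> fst ` (Z \<inter> Lo)"
  proof
    fix x assume "x \<in> A"
    then have "(x, 0) \<in> Z \<inter> Lo"
      using sub by (auto simp: defs)
    then show "x \<in> fst ` (Z \<inter> Lo)"
      by force
  qed
  then have "fst ` (Z \<inter> Lo) = A"
    by (auto simp: defs)
  moreover have "fst ` D = A \<inter> B"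
    by (simp add: D_def)
  moreover have "relative_homology_group p (subtopology Y (Z \<inter> Lo)) D
      \<cong> relative_homology_group p (subtopology X (fst ` (Z \<inter> Lo))) (fst ` D)"
    unfolding Y_def
  proof (rule relative_homology_prod_real[where c = 0])
    fix x s t :: real and y assume t: "0 \<le> t" "t \<le> 1"
    show "(y, s) \<in> Z \<inter> Lo \<Longrightarrow> (y, 0 + t * (s - 0)) \<in> Z \<inter> Lo"
      using t convex_comb_bounds(1)[OF t, of 0 1 s] by (auto simp: defs zero_less_mult_iff)
    show "(y, s) \<in> D \<Longrightarrow> (y, 0 + t * (s - 0)) \<in> D"
      using t convex_comb_bounds(1)[OF t, of 0 1 s] by (auto simp: defs)
  qed (use sub in \<open>auto simp: defs\<close>)
  ultimately have 1: "relative_homology_group p (subtopology X A) (A \<inter> B) \<cong> relative_homology_group p (subtopology Y (Z \<inter> Lo)) D"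
    by (simp add: group.iso_sym)
  \<comment> \<open>Level 1/2 is interior to the overlap, so the slide brings \<open>D\<close> into
    it without leaving it.\<close>
  have "acyclic_pair Y D (Z \<inter> Lo \<inter> Hi)"
    unfolding Y_def
    by (rule acyclic_pair_slide[where c = "1/2"])
      (use sub in \<open>auto simp: defs convex_comb_bounds(1,2)\<close>)
  then have 2: "incl_iso Y (Z \<inter> Lo) (Z \<inter> Lo \<inter> Hi) (Z \<inter> Lo) D"
    by (intro incl_iso_relativize) (use sub in \<open>auto simp: defs\<close>)
  have "openin Y Hi" "openin Y Lo"
    by (auto simp: Y_def Hi_def Lo_def openin_prod_Times_iff)
  moreover have "Z \<subseteq> topspace Y" "Z \<subseteq> Hi \<union> Lo"
    by (auto simp: topY defs)
  ultimately have "incl_iso Y (Z \<inter> Lo) (Z \<inter> Hi \<inter> Lo) Z (Z \<inter> Hi)"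
    by (rule incl_iso_open_excision)
  then have 3: "incl_iso Y (Z \<inter> Lo) (Z \<inter> Lo \<inter> Hi) Z (Z \<inter> Hi)"
    by (simp add: Int_ac)
  have "acyclic_pair Y (topspace Y) Z"
    using acyclic_pair_double_cylinder[OF fin A B AB] by (simp add: Y_def Z_def)
  then have 4: "incl_iso Y Z (Z \<inter> Hi) (topspace Y) (Z \<inter> Hi)"
    by (intro incl_iso_enlarge) (auto simp: topY defs)
  \<comment> \<open>Level 1 is chosen because from there on all of \<open>B\<close> belongs to
    \<open>Z\<close>.\<close>
  have "acyclic_pair Y (B \<times> UNIV) (Z \<inter> Hi)"
    unfolding Y_def
  proof (rule acyclic_pair_slide[where c = 1])
    fix x s t :: real and y assume t: "0 \<le> t" "t \<le> 1"
    show "(y, s) \<in> Z \<inter> Hi \<Longrightarrow> (y, 1 + t * (s - 1)) \<in> Z \<inter> Hi"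
      using convex_comb_bounds(2)[OF t, of 0 1 s] convex_comb_bounds(4)[OF t, of 1 1 s] by (force simp: defs)
  qed (use sub in \<open>auto simp: defs\<close>)
  then have 5: "incl_iso Y (topspace Y) (Z \<inter> Hi) (topspace Y) (B \<times> UNIV)"
    by (intro incl_iso_relativize) (use sub in \<open>auto simp: topY defs\<close>)
  have "relative_homology_group p (subtopology Y (topspace Y)) (B \<times> UNIV)
      \<cong> relative_homology_group p (subtopology X (fst ` topspace Y)) (fst ` (B \<times> (UNIV :: real set)))"
    unfolding Y_def by (rule relative_homology_prod_real[where c = 0]) (use sub in auto)
  then have 6: "relative_homology_group p (subtopology Y (topspace Y)) (B \<times> UNIV) \<cong> relative_homology_group p X B"
    by (simp add: topY)
  show ?thesis
    using 1 group.iso_sym[OF _ incl_iso_imp_isomorphic[OF 2, of p]] incl_iso_imp_isomorphic[OF 3, of p]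
      incl_iso_imp_isomorphic[OF 4, of p] incl_iso_imp_isomorphic[OF 5, of p] 6
    by (meson group_relative_homology_group iso_trans)
qed

lemma closed_excision:
  assumes "finite (topspace X)" "closedin X A" "closedin X B"
  shows "relative_homology_group p (subtopology X A) (A \<inter> B) \<cong> relative_homology_group p (subtopology X (A \<union> B)) B"
proof -
  have sub: "A \<subseteq> topspace X" "B \<subseteq> topspace X"
    using assms closedin_subset by auto
  have "relative_homology_group p (subtopology (subtopology X (A \<union> B)) A) (A \<inter> B)
      \<cong> relative_homology_group p (subtopology X (A \<union> B)) B"
    by (rule closed_excision_topspace) (use assms sub in \<open>auto intro: closedin_subset_topspace\<close>)
  moreover have "subtopology (subtopology X (A \<union> B)) A = subtopology X A"
    by (simp add: subtopology_subtopology Int_absorb1)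
  ultimately show ?thesis
    by simp
qed

section \<open>Finiteness of the homology of finite spaces\<close>

text \<open>The first clause makes \<open>group_rank\<close> a genuine maximum, the second makes the
  Betti numbers the coefficients of a polynomial.\<close>

definition finite_type_pair :: "'a topology \<Rightarrow> 'a set \<Rightarrow> 'a set \<Rightarrow> bool" where
  "finite_type_pair Y A B \<longleftrightarrow>
     (\<forall>p. finite_rank_in (relative_homology_group p (subtopology Y A) B) (carrier (relative_homology_group p (subtopology Y A) B))) \<and>
     (\<exists>N. \<forall>p\<ge>N. trivial_group (relative_homology_group p (subtopology Y A) B))"

lemma exact_middle_finite_rank:
  assumes "exact_seq ([G3, G2, G1], [g, f])" "comm_group G1" "comm_group G2" "comm_group G3"
    "finite_rank_in G1 (carrier G1)" "finite_rank_in G3 (carrier G3)"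
  shows "finite_rank_in G2 (carrier G2)"
proof -
  interpret f: comm_group_hom G1 G2 f
    using assms by (auto simp: comm_group_hom_def comm_group_hom_axioms_def group_hom_def group_hom_axioms_def)
  interpret g: comm_group_hom G2 G3 g
    using assms by (auto simp: comm_group_hom_def comm_group_hom_axioms_def group_hom_def group_hom_axioms_def)
  have "kernel G2 G3 g = f ` carrier G1"
    using assms by auto
  then show ?thesis
    using f.finite_rank_image g.finite_rank_extension assms by auto
qed

lemma finite_type_pair_middle:
  assumes "C \<subseteq> B" "B \<subseteq> A" "finite_type_pair Y B C" "finite_type_pair Y A B"
  shows "finite_type_pair Y A C"
  unfolding finite_type_pair_def
proof (intro conjI allI)
  fix p
  show "finite_rank_in (relative_homology_group p (subtopology Y A) C) (carrier (relative_homology_group p (subtopology Y A) C))"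
    by (rule exact_middle_finite_rank[OF triple_exact_middle[OF assms(1,2)]])
      (use assms(3,4) in \<open>auto simp: finite_type_pair_def\<close>)
next
  obtain N1 N2 where N: "\<And>p. p \<ge> N1 \<Longrightarrow> trivial_group (relative_homology_group p (subtopology Y B) C)"
      "\<And>p. p \<ge> N2 \<Longrightarrow> trivial_group (relative_homology_group p (subtopology Y A) B)"
    using assms(3,4) unfolding finite_type_pair_def by blast
  have "trivial_group (relative_homology_group p (subtopology Y A) C)" if "p \<ge> max N1 N2" for p
    by (rule exact_middle_trivial[OF triple_exact_middle[OF assms(1,2)]]) (use N that in auto)
  then show "\<exists>N. \<forall>p\<ge>N. trivial_group (relative_homology_group p (subtopology Y A) C)"
    by blast
qed

lemma finite_type_pair_quotient:
  assumes "C \<subseteq> B" "B \<subseteq> A" "finite_type_pair Y B C" "finite_type_pair Y A C"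
  shows "finite_type_pair Y A B"
  unfolding finite_type_pair_def
proof (intro conjI allI)
  fix p
  show "finite_rank_in (relative_homology_group p (subtopology Y A) B) (carrier (relative_homology_group p (subtopology Y A) B))"
    by (rule exact_middle_finite_rank[OF triple_exact_quotient[OF assms(1,2)]])
      (use assms(3,4) in \<open>auto simp: finite_type_pair_def\<close>)
next
  obtain N1 N2 where N: "\<And>p. p \<ge> N1 \<Longrightarrow> trivial_group (relative_homology_group p (subtopology Y B) C)"
      "\<And>p. p \<ge> N2 \<Longrightarrow> trivial_group (relative_homology_group p (subtopology Y A) C)"
    using assms(3,4) unfolding finite_type_pair_def by blast
  \<comment> \<open>The sequence continues from \<open>H_p(A, B)\<close> to
    \<open>H_(p-1)(B, C)\<close>, hence the shift of \<open>N1\<close> by one.\<close>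
  have "trivial_group (relative_homology_group p (subtopology Y A) B)" if "p \<ge> max (N1 + 1) N2" for p
    by (rule exact_middle_trivial[OF triple_exact_quotient[OF assms(1,2)]]) (use N that in auto)
  then show "\<exists>N. \<forall>p\<ge>N. trivial_group (relative_homology_group p (subtopology Y A) B)"
    by blast
qed

lemma finite_type_pair_iso:
  assumes "\<And>p. relative_homology_group p (subtopology Y A) B \<cong> relative_homology_group p (subtopology Y A') B'"
    "finite_type_pair Y A B"
  shows "finite_type_pair Y A' B'"
  unfolding finite_type_pair_def
proof (intro conjI allI)
  fix p
  show "finite_rank_in (relative_homology_group p (subtopology Y A') B') (carrier (relative_homology_group p (subtopology Y A') B'))"
    by (rule group_rank_iso(2)[OF _ _ assms(1)]) (use assms(2) in \<open>auto simp: finite_type_pair_def\<close>)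
next
  have "trivial_group (relative_homology_group p (subtopology Y A') B')
      \<longleftrightarrow> trivial_group (relative_homology_group p (subtopology Y A) B)" for p
    using isomorphic_group_triviality[OF assms(1)] by simp
  then show "\<exists>N. \<forall>p\<ge>N. trivial_group (relative_homology_group p (subtopology Y A') B')"
    using assms(2) by (simp add: finite_type_pair_def)
qed

text \<open>The homology is that of a point: the integers in degree 0 and nothing elsewhere.\<close>

lemma finite_type_pair_contractible:
  assumes "contractible_space (subtopology Y A)" "A \<inter> topspace Y \<noteq> {}"
  shows "finite_type_pair Y A {}"
proof -
  have "subtopology Y A \<noteq> trivial_topology"
    using assms(2) by (metis Int_commute null_topspace_iff_trivial topspace_subtopology)
  then obtain a where a: "a \<in> topspace (subtopology Y A)"
    "subtopology Y A homotopy_equivalent_space subtopology (subtopology Y A) {a}"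
    using assms(1) contractible_eq_homotopy_equivalent_singleton_subtopology by blast
  have iso: "homology_group p (subtopology Y A) \<cong> homology_group p (subtopology (subtopology Y A) {a})" for p
    using a(2) by (rule homotopy_equivalent_space_imp_isomorphic_homology_groups)
  have sing: "topspace (subtopology (subtopology Y A) {a}) = {a}"
    using a by auto
  have triv: "trivial_group (homology_group p (subtopology Y A))" if "p \<noteq> 0" for p
    using homology_dimension_axiom[OF sing that] iso[of p] by (simp add: isomorphic_group_triviality)
  have "integer_group \<cong> homology_group 0 (subtopology Y A)"
    using homology_coefficients[OF sing] iso[of 0] by (meson group.iso_sym group_relative_homology_group iso_trans)
  then have "finite_rank_in (homology_group 0 (subtopology Y A)) (carrier (homology_group 0 (subtopology Y A)))"
    by (intro group_rank_iso(2)[OF abelian_integer_group _ _ finite_rank_integer_group]) auto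
  moreover have "finite_rank_in (homology_group p (subtopology Y A)) (carrier (homology_group p (subtopology Y A)))" if "p \<noteq> 0" for p
    by (rule rank_in_trivial(2)) (use triv[OF that] in \<open>auto simp: trivial_group_def\<close>)
  ultimately show ?thesis
    using triv unfolding finite_type_pair_def by (metis not_one_le_zero)
qed

lemma finite_type_open:
  assumes fin: "finite (topspace X)" and W: "openin X W"
  shows "finite_type_pair X W {}"
  using fin W
proof (induction rule: finite_space_open_induct)
  case empty
  have "trivial_group (homology_group p (subtopology X {}))" for p
    by (simp add: trivial_homology_group_empty)
  then show ?case
    unfolding finite_type_pair_def
    by (metis abelian_relative_homology_group order_refl rank_in_trivial(2) trivial_group_def)
next
  case (min x)
  then show ?case
    using contractible_min_open[OF min] in_min_open[of x X] by (intro finite_type_pair_contractible) auto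
next
  case (Un U V)
  have fin_V: "finite_type_pair X V (U \<inter> V)"
    by (rule finite_type_pair_quotient[of "{}"]) (use Un in auto)
  \<comment> \<open>Excision trades the union relative to \<open>U\<close> for \<open>V\<close>
    relative to \<open>U \<inter> V\<close>, whose finiteness comes from the induction
    hypotheses.\<close>
  have "incl_iso X V (U \<inter> V) (U \<union> V) U"
  proof -
    have "U \<union> V \<subseteq> topspace X"
      using Un openin_subset by blast
    then have "incl_iso X ((U \<union> V) \<inter> V) ((U \<union> V) \<inter> U \<inter> V) (U \<union> V) ((U \<union> V) \<inter> U)"
      using Un by (intro incl_iso_open_excision) auto
    moreover have "(U \<union> V) \<inter> V = V" "(U \<union> V) \<inter> U \<inter> V = U \<inter> V" "(U \<union> V) \<inter> U = U"
      by auto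
    ultimately show ?thesis
      by simp
  qed
  then have "finite_type_pair X (U \<union> V) U"
    by (intro finite_type_pair_iso[OF _ fin_V] incl_iso_imp_isomorphic)
  then show ?case
    by (rule finite_type_pair_middle[OF empty_subsetI Un_upper1 Un(3)])
qed

lemma finite_type_finite_space:
  assumes "finite (topspace X)" "B \<subseteq> A" "A \<subseteq> topspace X"
  shows "finite_type_pair X A B"
proof -
  have *: "finite_type_pair X C {}" if "C \<subseteq> topspace X" for C
  proof -
    \<comment> \<open>\<open>C\<close> may fail to be open in \<open>X\<close>, but it is open in
      its own subspace, which is again finite.\<close>
    have "finite_type_pair (subtopology X C) (topspace (subtopology X C)) {}"
      by (rule finite_type_open[OF _ openin_topspace]) (use assms in simp)
    then show ?thesis
      using that by (simp add: finite_type_pair_def Int_absorb1 subtopology_subtopology)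
  qed
  show ?thesis
    by (rule finite_type_pair_quotient[OF empty_subsetI assms(2) * *]) (use assms in auto)
qed

section \<open>Poincare polynomials of closed pairs\<close>

lemma exact_rank:
  assumes ex: "exact_seq ([G3, G2, G1], [g, f])" and comm: "comm_group G2" "comm_group G3"
    and fin: "finite_rank_in G2 (carrier G2)"
  shows "group_rank G2 = rank_in G2 (f ` carrier G1) + rank_in G3 (g ` carrier G2)"
proof -
  interpret g: comm_group_hom G2 G3 g
    using ex comm by (auto simp: comm_group_hom_def comm_group_hom_axioms_def)
  have "kernel G2 G3 g = f ` carrier G1"
    using ex by auto
  then show ?thesis
    using g.rank_nullity[OF fin] by simp
qed

text \<open>The homology of a closed pair depends only on the difference: the closure of
  \<open>P - Q\<close> together with \<open>Q\<close> is \<open>P\<close>, and it meets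
  \<open>Q\<close> in the mouth, so closed excision applies.\<close>

lemma homology_closed_difference:
  assumes "finite (topspace X)" "closedin X P" "closedin X Q" "Q \<subseteq> P"
  shows "relative_homology_group p (subtopology X (mcl X (P - Q))) (mouth X (P - Q))
       \<cong> relative_homology_group p (subtopology X P) Q"
proof -
  have "P - Q \<subseteq> topspace X"
    using assms closedin_subset by blast
  then have cl: "P - Q \<subseteq> mcl X (P - Q)" "mcl X (P - Q) \<subseteq> P"
    using assms unfolding mcl_def by (simp_all add: closure_of_subset closure_of_minimal)
  then have "mcl X (P - Q) \<inter> Q = mouth X (P - Q)" "mcl X (P - Q) \<union> Q = P"
    using assms by (auto simp: mouth_def)
  then show ?thesis
    using closed_excision[OF assms(1), of "mcl X (P - Q)" Q p] assms(3) by (simp add: mcl_def)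
qed

text \<open>The correction \<open>q\<close> collects the ranks of the connecting homomorphisms \<open>H_{k+1}(P, Q) \<rightarrow> H_k(Q)\<close>.\<close>

lemma poincare_closed_pair:
  assumes fin: "finite (topspace X)" and closed: "closedin X P" "closedin X Q" and QP: "Q \<subseteq> P"
    and iso: "\<And>p. relative_homology_group p (subtopology X P) Q
      \<cong> relative_homology_group p (subtopology X (mcl X S)) (mouth X S)"
  obtains q where "poincare X S + poincare X Q = poincare X P + [:1, 1:] * q"
    "q \<noteq> 0 \<Longrightarrow> \<exists>p. \<not> inj_on (hom_induced p (subtopology X Q) {} (subtopology X P) {} id)
       (carrier (homology_group p (subtopology X Q)))"
proof -
  let ?HQ = "\<lambda>p. homology_group p (subtopology X Q)"
  let ?HP = "\<lambda>p. homology_group p (subtopology X P)"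
  let ?HR = "\<lambda>p. relative_homology_group p (subtopology X P) Q"
  let ?i = "\<lambda>p. hom_induced p (subtopology X Q) {} (subtopology X P) {} id"
  let ?j = "\<lambda>p. hom_induced p (subtopology X P) {} (subtopology X P) Q id"
  let ?d = "\<lambda>p. hom_relboundary p (subtopology X P) Q {}"
  have sub: "P \<subseteq> topspace X" "Q \<subseteq> topspace X"
    using closed closedin_subset by auto
  have ft: "finite_type_pair X Q {}" "finite_type_pair X P {}" "finite_type_pair X P Q"
    using finite_type_finite_space[OF fin] sub QP by auto
  note ex = triple_exact[OF empty_subsetI QP, of _ X]
  have exQ: "exact_seq ([?HP p, ?HQ p, ?HR (p + 1)], [?i p, ?d (p + 1)])" for p
    using ex[of "p + 1"] by (simp add: group_hom_def group_hom_axioms_def)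
  \<comment> \<open>\<open>r p\<close> belongs to the connecting map that lands in degree
    \<open>p\<close>; the one leaving \<open>H_p(P, Q)\<close> therefore contributes
    \<open>r (p - 1)\<close>.\<close>
  define r where "r p = rank_in (?HQ p) (?d (p + 1) ` carrier (?HR (p + 1)))" for p
  \<comment> \<open>Rank-nullity at three consecutive terms of the sequence; the ranks of the images
    of \<open>?i p\<close> and \<open>?j p\<close> occur on both sides and cancel.\<close>
  have rk: "group_rank (?HR p) + group_rank (?HQ p) = group_rank (?HP p) + r p + r (p - 1)" for p
  proof -
    have "group_rank (?HQ p) = r p + rank_in (?HP p) (?i p ` carrier (?HQ p))"
      unfolding r_def by (rule exact_rank[OF exQ]) (use ft in \<open>auto simp: finite_type_pair_def\<close>)
    moreover have "group_rank (?HP p) = rank_in (?HP p) (?i p ` carrier (?HQ p)) + rank_in (?HR p) (?j p ` carrier (?HP p))"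
      by (rule exact_rank[OF triple_exact_middle[OF empty_subsetI QP]]) (use ft in \<open>auto simp: finite_type_pair_def\<close>)
    moreover have "group_rank (?HR p) = rank_in (?HR p) (?j p ` carrier (?HP p)) + r (p - 1)"
      using exact_rank[OF triple_exact_quotient[OF empty_subsetI QP], of p X] ft
      by (auto simp: finite_type_pair_def r_def)
    ultimately show ?thesis
      by simp
  qed
  have rank_triv: "group_rank G = 0" if "trivial_group G" "comm_group G" for G :: "'a chain set monoid"
    using that rank_in_trivial(1)[of G "carrier G"] by (auto simp: group_rank_eq trivial_group_def)
  \<comment> \<open>This bounds \<open>r\<close> by ranks that vanish in high degrees, so that
    \<open>r\<close> is the coefficient sequence of a polynomial, and also in degree -1.\<close>
  have le_rank: "r p \<le> group_rank (?HQ p)" for p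
    using rk[of p] exact_rank[OF exQ, of p] ft by (simp add: finite_type_pair_def r_def)
  have evz: "\<exists>N. \<forall>k>N. group_rank (relative_homology_group (int k) (subtopology X A) B) = 0"
    if AB: "finite_type_pair X A B" for A B
  proof -
    obtain N where "\<And>p. p \<ge> N \<Longrightarrow> trivial_group (relative_homology_group p (subtopology X A) B)"
      using AB unfolding finite_type_pair_def by blast
    then have "group_rank (relative_homology_group (int k) (subtopology X A) B) = 0" if "k > nat N" for k
      by (intro rank_triv) (use that in auto)
    then show ?thesis
      by blast
  qed
  have coeff_P: "poly.coeff (poincare X K) k = group_rank (homology_group (int k) (subtopology X K))"
    if K': "closedin X K" "finite_type_pair X K {}" for K k
  proof -
    have K: "mcl X K = K" "mouth X K = {}"
      using K' by (auto simp: mcl_def mouth_def closure_of_closedin)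
    obtain N where "\<forall>k>N. betti X K k = 0"
      using evz[OF K'(2)] unfolding betti_def K by auto
    then have "poly.coeff (poincare X K) = betti X K"
      unfolding poincare_def by (intro coeff_Abs_poly) auto
    then show ?thesis
      by (simp add: betti_def K)
  qed
  have betti_S: "betti X S k = group_rank (?HR (int k))" for k
    unfolding betti_def
    by (rule group_rank_iso(1)[OF _ _ iso, symmetric]) (use ft(3) in \<open>auto simp: finite_type_pair_def\<close>)
  then obtain N where "\<forall>k>N. betti X S k = 0"
    using evz[OF ft(3)] by auto
  then have coeff_S: "poly.coeff (poincare X S) k = group_rank (?HR (int k))" for k
    unfolding poincare_def betti_S[symmetric] by (subst coeff_Abs_poly[of N]) auto
  define q where "q = Abs_poly (\<lambda>k. r (int k))"
  obtain N where N: "\<forall>k>N. group_rank (?HQ (int k)) = 0"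
    using evz[OF ft(1)] by auto
  then have coeff_q: "poly.coeff q k = r (int k)" for k
    unfolding q_def using le_rank by (subst coeff_Abs_poly[of N]) (metis le_zero_eq, auto)
  \<comment> \<open>In degree 0 the product with \<open>[:1, 1:]\<close> has no lower coefficient of
    \<open>q\<close> to contribute, whereas \<open>rk\<close> involves
    \<open>r (-1)\<close>.\<close>
  have r_neg: "r (-1) = 0"
    using le_rank[of "-1"] rank_triv[of "?HQ (-1)"] by simp
  show ?thesis
  proof
    show "poincare X S + poincare X Q = poincare X P + [:1, 1:] * q"
    proof (rule poly_eqI)
      fix k
      have "poly.coeff ([:1, 1:] * q) k = r (int k) + r (int k - 1)"
        using r_neg by (cases k) (simp_all add: coeff_q coeff_pCons)
      then show "poly.coeff (poincare X S + poincare X Q) k = poly.coeff (poincare X P + [:1, 1:] * q) k"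
        using rk[of "int k"] ft closed by (simp add: coeff_S coeff_P)
    qed
  next
    assume "q \<noteq> 0"
    then obtain k where k: "r (int k) \<noteq> 0"
      by (metis coeff_q leading_coeff_0_iff)
    \<comment> \<open>By exactness the image of the connecting map is the kernel of
      \<open>?i\<close>; were this trivial, its rank would be 0.\<close>
    have "\<not> inj_on (?i (int k)) (carrier (?HQ (int k)))"
    proof
      assume inj: "inj_on (?i (int k)) (carrier (?HQ (int k)))"
      have gh: "group_hom (?HQ (int k)) (?HP (int k)) (?i (int k))"
        and ker: "kernel (?HQ (int k)) (?HP (int k)) (?i (int k)) = ?d (int k + 1) ` carrier (?HR (int k + 1))"
        using exQ[of "int k"] by (auto simp: group_hom_def group_hom_axioms_def)
      then have "?d (int k + 1) ` carrier (?HR (int k + 1)) = {\<one>\<^bsub>?HQ (int k)\<^esub>}"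
        using inj group_hom.inj_iff_trivial_ker by metis
      then have "r (int k) = 0"
        unfolding r_def by (intro rank_in_trivial(1)) auto
      then show False
        using k by simp
    qed
    then show "\<exists>p. \<not> inj_on (?i p) (carrier (?HQ p))"
      by blast
  qed
qed

text \<open>\<open>Q\<close> is open and closed in \<open>P\<close>, hence empty or a retract of
  \<open>P\<close>, and the inclusion of a retract is injective on homology.\<close>

lemma inj_on_hom_induced_clopen:
  assumes "closedin X P" "closedin X Q" "closedin X R" "P = Q \<union> R" "Q \<inter> R = {}"
  shows "inj_on (hom_induced p (subtopology X Q) {} (subtopology X P) {} id) (carrier (homology_group p (subtopology X Q)))"
proof -
  have sub: "Q \<subseteq> P" "P \<subseteq> topspace X"
    using assms closedin_subset by auto
  have "closedin (subtopology X P) Q"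
    using assms sub by (intro closedin_subset_topspace)
  moreover have "openin (subtopology X P) Q"
  proof -
    have "closedin (subtopology X P) R"
      using assms by (intro closedin_subset_topspace) auto
    moreover have "topspace (subtopology X P) - R = Q"
      using assms sub by auto
    ultimately show ?thesis
      by (metis openin_diff openin_topspace)
  qed
  ultimately have "Q = {} \<or> Q retract_of_space (subtopology X P)"
    using retract_of_space_clopen by blast
  then have "inj_on (hom_induced p (subtopology (subtopology X P) Q) {} (subtopology X P) {} id)
      (carrier (homology_group p (subtopology (subtopology X P) Q)))"
    by (rule inj_on_hom_induced_inclusion)
  moreover have "subtopology (subtopology X P) Q = subtopology X Q"
    using sub by (simp add: subtopology_subtopology Int_absorb1)
  ultimately show ?thesis
    by simp
qed

lemma poincare_empty: "poincare X {} = 0"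
proof -
  have "trivial_group (homology_group p (subtopology X {}))" for p
    by (simp add: trivial_homology_group_empty)
  then have "betti X {} k = 0" for k
    using rank_in_trivial(1)[of "homology_group (int k) (subtopology X {})" "carrier (homology_group (int k) (subtopology X {}))"]
    by (auto simp: betti_def mcl_def mouth_def group_rank_eq trivial_group_def)
  then show ?thesis
    unfolding poincare_def by (intro poly_eqI) (subst coeff_Abs_poly[of 0], auto)
qed

section \<open>Solutions of multivector fields\<close>

lemma mem_uim_minus: "y \<in> uim_minus \<phi> \<longleftrightarrow> (\<forall>m. \<exists>s\<le>m. \<phi> s = y)"
proof
  assume y: "y \<in> uim_minus \<phi>"
  show "\<forall>m. \<exists>s\<le>m. \<phi> s = y"
  proof
    fix m
    have "y \<in> \<phi> ` {..min m 0}"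
      using y by (auto simp: uim_minus_def)
    then show "\<exists>s\<le>m. \<phi> s = y"
      by auto
  qed
next
  assume "\<forall>m. \<exists>s\<le>m. \<phi> s = y"
  then have "y \<in> \<phi> ` {..m}" for m
    by (metis atMost_iff imageI)
  then show "y \<in> uim_minus \<phi>"
    by (simp add: uim_minus_def)
qed

lemma mem_uim_plus: "y \<in> uim_plus \<phi> \<longleftrightarrow> (\<forall>m. \<exists>s\<ge>m. \<phi> s = y)"
proof
  assume y: "y \<in> uim_plus \<phi>"
  show "\<forall>m. \<exists>s\<ge>m. \<phi> s = y"
  proof
    fix m
    have "y \<in> \<phi> ` {max m 0..}"
      using y by (auto simp: uim_plus_def)
    then show "\<exists>s\<ge>m. \<phi> s = y"
      by auto
  qed
next
  assume "\<forall>m. \<exists>s\<ge>m. \<phi> s = y"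
  then have "y \<in> \<phi> ` {m..}" for m
    by (metis atLeast_iff imageI)
  then show "y \<in> uim_plus \<phi>"
    by (simp add: uim_plus_def)
qed

lemma uim_subset_range: "uim_minus \<phi> \<subseteq> range \<phi>" "uim_plus \<phi> \<subseteq> range \<phi>"
  by (auto simp: uim_minus_def uim_plus_def)

lemma uim_plus_eq_reverse: "uim_plus \<phi> = uim_minus (\<lambda>t. \<phi> (- t))"
proof -
  have "(\<exists>s\<ge>m. \<phi> s = y) \<longleftrightarrow> (\<exists>s\<le>- m. \<phi> (- s) = y)" for m y
  proof safe
    fix s assume "m \<le> s"
    then show "\<exists>t\<le>- m. \<phi> (- t) = \<phi> s"
      by (intro exI[of _ "- s"]) auto
  next
    fix s assume "s \<le> - m"
    then show "\<exists>t\<ge>m. \<phi> t = \<phi> (- s)"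
      by (intro exI[of _ "- s"]) auto
  qed
  then have "(\<forall>m. \<exists>s\<ge>m. \<phi> s = y) \<longleftrightarrow> (\<forall>m. \<exists>s\<le>m. \<phi> (- s) = y)" for y
    using minus_minus by metis
  then show ?thesis
    by (auto simp: mem_uim_minus mem_uim_plus)
qed

lemma uim_minus_nonempty:
  assumes "finite (range \<phi>)" shows "uim_minus \<phi> \<noteq> {}"
proof
  assume "uim_minus \<phi> = {}"
  then have "\<not> (\<forall>m. \<exists>s\<le>m. \<phi> s = y)" for y
    by (simp flip: mem_uim_minus)
  then have "\<forall>y. \<exists>m. \<forall>s\<le>m. \<phi> s \<noteq> y"
    by simp
  then obtain m where m: "\<And>y s. s \<le> m y \<Longrightarrow> \<phi> s \<noteq> y"
    by metis
  \<comment> \<open>Each value \<open>y\<close> is avoided up to time \<open>m y\<close>; the value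
    taken at the earliest of these times violates its own bound.\<close>
  have "Min (m ` range \<phi>) \<le> m (\<phi> (Min (m ` range \<phi>)))"
    using assms by (intro Min_le) auto
  then show False
    using m by blast
qed

lemma uim_plus_nonempty:
  assumes "finite (range \<phi>)" shows "uim_plus \<phi> \<noteq> {}"
  unfolding uim_plus_eq_reverse by (rule uim_minus_nonempty) (rule finite_subset[OF _ assms], auto)

lemma subset_vhull: "A \<subseteq> vhull X V A"
  by (auto simp: vhull_def)

text \<open>\<phi> is shifted by one, so that \<open>\<phi> 0\<close> survives at time -1 while
  \<open>\<psi> 0\<close> sits at time 0: the join is the single step from \<open>\<phi> 0\<close>
  to \<open>\<psi> 0\<close>.\<close>

definition splice :: "(int \<Rightarrow> 'a) \<Rightarrow> (int \<Rightarrow> 'a) \<Rightarrow> int \<Rightarrow> 'a" where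
  "splice \<phi> \<psi> t = (if t < 0 then \<phi> (t + 1) else \<psi> t)"

lemma uim_minus_splice: "uim_minus (splice \<phi> \<psi>) = uim_minus \<phi>"
proof -
  have "(\<forall>m. \<exists>s\<le>m. splice \<phi> \<psi> s = y) \<longleftrightarrow> (\<forall>m. \<exists>s\<le>m. \<phi> s = y)" for y
  proof safe
    fix m assume "\<forall>m. \<exists>s\<le>m. splice \<phi> \<psi> s = y"
    then obtain s where "s \<le> min (m - 1) (-1)" "splice \<phi> \<psi> s = y" by blast
    then show "\<exists>s\<le>m. \<phi> s = y"
      by (intro exI[of _ "s + 1"]) (auto simp: splice_def)
  next
    fix m assume "\<forall>m. \<exists>s\<le>m. \<phi> s = y"
    then obtain s where "s \<le> min m 0" "\<phi> s = y" by blast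
    then show "\<exists>s\<le>m. splice \<phi> \<psi> s = y"
      by (intro exI[of _ "s - 1"]) (auto simp: splice_def)
  qed
  then show ?thesis
    by (auto simp: mem_uim_minus)
qed

lemma uim_plus_splice: "uim_plus (splice \<phi> \<psi>) = uim_plus \<psi>"
proof -
  have "(\<forall>m. \<exists>s\<ge>m. splice \<phi> \<psi> s = y) \<longleftrightarrow> (\<forall>m. \<exists>s\<ge>m. \<psi> s = y)" for y
  proof safe
    fix m assume "\<forall>m. \<exists>s\<ge>m. splice \<phi> \<psi> s = y"
    then obtain s where "s \<ge> max m 0" "splice \<phi> \<psi> s = y" by blast
    then show "\<exists>s\<ge>m. \<psi> s = y"
      by (intro exI[of _ s]) (auto simp: splice_def)
  next
    fix m assume "\<forall>m. \<exists>s\<ge>m. \<psi> s = y"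
    then obtain s where "s \<ge> max m 0" "\<psi> s = y" by blast
    then show "\<exists>s\<ge>m. splice \<phi> \<psi> s = y"
      by (intro exI[of _ s]) (auto simp: splice_def)
  qed
  then show ?thesis
    by (auto simp: mem_uim_plus)
qed

lemma uim_shift: "uim_minus (\<lambda>t. \<phi> (t + k)) = uim_minus \<phi>" "uim_plus (\<lambda>t. \<phi> (t + k)) = uim_plus \<phi>"
proof -
  have "\<phi> (s - k + k) = \<phi> s" for s
    by simp
  then have "(\<forall>m. \<exists>s\<le>m. \<phi> (s + k) = y) \<longleftrightarrow> (\<forall>m. \<exists>s\<le>m. \<phi> s = y)"
    "(\<forall>m. \<exists>s\<ge>m. \<phi> (s + k) = y) \<longleftrightarrow> (\<forall>m. \<exists>s\<ge>m. \<phi> s = y)" for y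
    by (metis add_le_cancel_right diff_add_cancel)+
  then show "uim_minus (\<lambda>t. \<phi> (t + k)) = uim_minus \<phi>" "uim_plus (\<lambda>t. \<phi> (t + k)) = uim_plus \<phi>"
    by (auto simp: mem_uim_minus mem_uim_plus)
qed

section \<open>Cells, forward invariant sets and hulls\<close>

locale finite_mvf =
  fixes X :: "'a topology" and V :: "'a set set"
  assumes fin: "finite (topspace X)" and mvf: "multivector_field X V"
begin

abbreviation cell :: "'a \<Rightarrow> 'a set" where "cell \<equiv> mvcell V"

lemma cell_eqI: "W \<in> V \<Longrightarrow> x \<in> W \<Longrightarrow> cell x = W"
  unfolding mvcell_def using mvf unfolding multivector_field_def
  by (intro the_equality) (blast, metis IntI empty_iff)

lemma cell:
  assumes "x \<in> topspace X" shows "cell x \<in> V" "x \<in> cell x" "cell x \<subseteq> topspace X"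
proof -
  have U: "\<Union>V = topspace X"
    using mvf by (simp add: multivector_field_def)
  obtain W where W: "W \<in> V" "x \<in> W"
    using assms U by blast
  then show "cell x \<in> V" "x \<in> cell x" "cell x \<subseteq> topspace X"
    using cell_eqI[OF W] U by auto
qed

lemma cell_cong: "x \<in> topspace X \<Longrightarrow> y \<in> cell x \<Longrightarrow> cell y = cell x"
  using cell_eqI cell by blast

lemma Pi_refl: "x \<in> topspace X \<Longrightarrow> x \<in> Pi_pt X V x"
  using cell by (auto simp: Pi_pt_def)

lemma Pi_sub: "x \<in> topspace X \<Longrightarrow> Pi_pt X V x \<subseteq> topspace X"
  using cell closure_of_subset_topspace by (fastforce simp: Pi_pt_def mcl_def)

lemma closure_finite: "A \<subseteq> topspace X \<Longrightarrow> X closure_of A = (\<Union>x\<in>A. X closure_of {x})"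
  using closure_of_Union[of "(\<lambda>x. {x}) ` A" X] finite_subset[OF _ fin] by (simp add: finite_imageI)

definition Pi_closed :: "'a set \<Rightarrow> bool" where
  "Pi_closed A \<longleftrightarrow> A \<subseteq> topspace X \<and> (\<forall>x\<in>A. Pi_pt X V x \<subseteq> A)"

text \<open>Exactly the sets over which \<open>vhull\<close> takes its intersection.\<close>

definition compat_lc :: "'a set \<Rightarrow> bool" where
  "compat_lc B \<longleftrightarrow> B \<subseteq> topspace X \<and> compatible X V B \<and> loc_closed X B"

lemma Pi_closedD: "Pi_closed A \<Longrightarrow> x \<in> A \<Longrightarrow> y \<in> Pi_pt X V x \<Longrightarrow> y \<in> A"
  by (auto simp: Pi_closed_def)

lemma Pi_closed_sub: "Pi_closed A \<Longrightarrow> A \<subseteq> topspace X"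
  by (auto simp: Pi_closed_def)

lemma Pi_closed_cell: "Pi_closed A \<Longrightarrow> x \<in> A \<Longrightarrow> cell x \<subseteq> A"
  by (auto simp: Pi_closed_def Pi_pt_def)

lemma closedin_Pi_closed:
  assumes "Pi_closed A" shows "closedin X A"
proof -
  have "X closure_of A \<subseteq> A"
    using assms closure_finite[of A] by (auto simp: Pi_closed_def Pi_pt_def mcl_def)
  then show ?thesis
    using closure_of_subset_eq Pi_closed_sub[OF assms] by blast
qed

lemma compat_lc_Pi_closed:
  assumes "Pi_closed A" shows "compat_lc A"
  unfolding compat_lc_def
proof (intro conjI)
  show sub: "A \<subseteq> topspace X"
    using assms by (rule Pi_closed_sub)
  show "loc_closed X A"
    unfolding loc_closed_def
    using closedin_Pi_closed[OF assms] sub by (intro exI[of _ "topspace X"] exI[of _ A]) auto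
  show "compatible X V A"
    unfolding compatible_def
  proof (intro ballI)
    fix x assume x: "x \<in> topspace X"
    show "cell x \<inter> A = {} \<or> cell x \<subseteq> A"
      using Pi_closed_cell[OF assms] cell_cong[OF x] by blast
  qed
qed

text \<open>The point where hulls are eliminated: a set of this kind is itself one of the sets
  intersected, so it contains the hull as soon as it contains the ultimate image.\<close>

lemma alpha_lim_subset: "compat_lc B \<Longrightarrow> alpha_lim X V \<phi> \<subseteq> B \<longleftrightarrow> uim_minus \<phi> \<subseteq> B"
  using subset_vhull[of "uim_minus \<phi>" X V] by (auto simp: alpha_lim_def compat_lc_def vhull_def)

lemma omega_lim_subset: "compat_lc B \<Longrightarrow> omega_lim X V \<phi> \<subseteq> B \<longleftrightarrow> uim_plus \<phi> \<subseteq> B"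
  using subset_vhull[of "uim_plus \<phi>" X V] by (auto simp: omega_lim_def compat_lc_def vhull_def)

lemma mem_min_open_iff: "s \<in> topspace X \<Longrightarrow> x \<in> min_open X s \<longleftrightarrow> s \<in> X closure_of {x}"
  by (auto simp: min_open_def in_closure_of)

text \<open>Paths of three points suffice: a point reached from \<open>S\<close> in one step lies in
  \<open>N\<close>, and if one more step leads back to \<open>S\<close>, isolation puts it in
  \<open>S\<close>. Compatibility follows because points of a cell reach each other, local
  closedness because membership in point closures is also a step.\<close>

lemma compat_lc_isolated:
  assumes "isolated_invariant X V S" "S \<subseteq> topspace X" shows "compat_lc S"
proof -
  obtain N where N: "isolates X V N S"
    using assms by (auto simp: isolated_invariant_def)
  have PiN: "y \<in> N" if "x \<in> S" "y \<in> Pi_pt X V x" for x y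
    using N that by (auto simp: isolates_def Pi_set_def)
  have between: "y \<in> S" if xyz: "x \<in> S" "z \<in> S" "y \<in> Pi_pt X V x" "z \<in> Pi_pt X V y" for x y z
  proof -
    define \<phi> where "\<phi> = (\<lambda>i::int. if i \<le> 0 then x else if i = 1 then y else z)"
    have "path_sol X V N 0 2 \<phi>"
      unfolding path_sol_def
    proof (intro conjI ballI allI impI)
      fix i :: int assume "i \<in> {0..2}"
      then show "\<phi> i \<in> N"
        using N xyz PiN by (auto simp: \<phi>_def isolates_def)
    next
      fix i :: int assume "0 \<le> i \<and> i + 1 \<le> 2"
      then have "i = 0 \<or> i = 1" by auto
      then show "\<phi> (i + 1) \<in> Pi_pt X V (\<phi> i)"
        using xyz by (auto simp: \<phi>_def)
    qed simp
    moreover have "\<phi> 0 \<in> S" "\<phi> 2 \<in> S"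
      using xyz by (auto simp: \<phi>_def)
    ultimately have "\<phi> ` {0..2} \<subseteq> S"
      using N unfolding isolates_def by blast
    then have "\<phi> 1 \<in> S"
      by auto
    then show ?thesis
      by (simp add: \<phi>_def)
  qed
  have "compatible X V S"
    unfolding compatible_def
  proof
    fix x assume x: "x \<in> topspace X"
    have "cell x \<subseteq> S" if y: "y \<in> cell x" "y \<in> S" for y
    proof
      fix z assume z: "z \<in> cell x"
      have "y \<in> topspace X" "z \<in> topspace X"
        using y(1) z cell(3)[OF x] by auto
      then have "z \<in> Pi_pt X V y" "y \<in> Pi_pt X V z"
        using cell_cong[OF x y(1)] cell_cong[OF x z] cell(2) y z unfolding Pi_pt_def by auto
      then show "z \<in> S"
        using between y(2) by blast
    qed
    then show "cell x \<inter> S = {} \<or> cell x \<subseteq> S"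
      by blast
  qed
  moreover have "loc_closed X S"
    unfolding loc_closed_def
  proof (intro exI conjI)
    \<comment> \<open>A point of this open set has a point of \<open>S\<close> in its closure, and a
      point of the closure of \<open>S\<close> lies in the closure of a point of \<open>S\<close>. A
      point with both properties lies between two points of \<open>S\<close>.\<close>
    show "openin X (\<Union>s\<in>S. min_open X s)"
      using openin_min_open[OF fin] assms(2) by blast
    show "closedin X (X closure_of S)"
      by simp
    have "y \<in> S" if y: "y \<in> min_open X s" "s \<in> S" "y \<in> X closure_of S" for y s
    proof -
      obtain s' where s': "s' \<in> S" "y \<in> X closure_of {s'}"
        using y(3) closure_finite[OF assms(2)] by blast
      then have "y \<in> Pi_pt X V s'" "s \<in> Pi_pt X V y"
        using mem_min_open_iff[of s y] y assms(2) by (auto simp: Pi_pt_def mcl_def)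
      then show ?thesis
        using between s' y by blast
    qed
    then show "S = (\<Union>s\<in>S. min_open X s) \<inter> X closure_of S"
      using closure_of_subset[OF assms(2)] in_min_open[of _ X] by blast
  qed
  ultimately show ?thesis
    using assms by (simp add: compat_lc_def)
qed

section \<open>Essential solutions\<close>

abbreviation ess :: "(int \<Rightarrow> 'a) \<Rightarrow> bool" where
  "ess \<phi> \<equiv> ess_full_solution X V (topspace X) \<phi>"

lemma ess_mono: "ess_full_solution X V A \<phi> \<Longrightarrow> A \<subseteq> B \<Longrightarrow> ess_full_solution X V B \<phi>"
  by (auto simp: ess_full_solution_def full_solution_def)

lemma ess_in: "ess \<phi> \<Longrightarrow> \<phi> t \<in> topspace X"
  by (auto simp: ess_full_solution_def full_solution_def)

lemma ess_step: "ess \<phi> \<Longrightarrow> \<phi> (t + 1) \<in> Pi_pt X V (\<phi> t)"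
  by (auto simp: ess_full_solution_def full_solution_def)

lemma ess_range: "ess \<phi> \<Longrightarrow> range \<phi> \<subseteq> A \<Longrightarrow> ess_full_solution X V A \<phi>"
  by (auto simp: ess_full_solution_def full_solution_def)

lemma ess_uim_nonempty:
  assumes "ess \<phi>" shows "uim_minus \<phi> \<noteq> {}" "uim_plus \<phi> \<noteq> {}"
proof -
  have "finite (range \<phi>)"
    by (rule finite_subset[OF _ fin]) (use ess_in[OF assms] in auto)
  then show "uim_minus \<phi> \<noteq> {}" "uim_plus \<phi> \<noteq> {}"
    using uim_minus_nonempty uim_plus_nonempty by auto
qed

lemma ess_shift:
  assumes "ess \<phi>" shows "ess (\<lambda>t. \<phi> (t + k))"
proof -
  have esc: "\<exists>s\<le>m. \<phi> s \<notin> cell (\<phi> t)" "\<exists>s\<ge>m. \<phi> s \<notin> cell (\<phi> t)" if "regular X (cell (\<phi> t))" for t m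
    using assms that by (auto simp: ess_full_solution_def essential_def)
  have step: "\<phi> (t + 1 + k) \<in> Pi_pt X V (\<phi> (t + k))" for t
  proof -
    have eq: "t + 1 + k = t + k + 1"
      by simp
    show ?thesis
      unfolding eq by (rule ess_step[OF assms])
  qed
  have "\<exists>s\<le>m. \<phi> (s + k) \<notin> cell (\<phi> (t + k))" if reg: "regular X (cell (\<phi> (t + k)))" for t m
  proof -
    obtain s where "s \<le> m + k" "\<phi> s \<notin> cell (\<phi> (t + k))"
      using esc(1)[OF reg] by blast
    then show ?thesis
      by (intro exI[of _ "s - k"]) auto
  qed
  moreover have "\<exists>s\<ge>m. \<phi> (s + k) \<notin> cell (\<phi> (t + k))" if reg: "regular X (cell (\<phi> (t + k)))" for t m
  proof -
    obtain s where "s \<ge> m + k" "\<phi> s \<notin> cell (\<phi> (t + k))"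
      using esc(2)[OF reg] by blast
    then show ?thesis
      by (intro exI[of _ "s - k"]) auto
  qed
  ultimately show ?thesis
    using step ess_in[OF assms] by (simp add: ess_full_solution_def full_solution_def essential_def)
qed

text \<open>Being essential concerns only the two tails, which are inherited from \<phi> and from
  \<psi>.\<close>

lemma ess_splice:
  assumes \<phi>: "ess \<phi>" and \<psi>: "ess \<psi>" and link: "\<psi> 0 \<in> Pi_pt X V (\<phi> 0)"
  shows "ess (splice \<phi> \<psi>)"
proof -
  let ?\<chi> = "splice \<phi> \<psi>"
  have "?\<chi> t \<in> topspace X" for t
    using ess_in[OF \<phi>] ess_in[OF \<psi>] by (simp add: splice_def)
  moreover have "?\<chi> (t + 1) \<in> Pi_pt X V (?\<chi> t)" for t
  proof -
    consider "t < -1" | "t = -1" | "t \<ge> 0" by linarith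
    then show ?thesis
      by cases (use link ess_step[OF \<phi>, of "t + 1"] ess_step[OF \<psi>, of t] in \<open>auto simp: splice_def\<close>)
  qed
  moreover have "(\<exists>s\<le>m. ?\<chi> s \<notin> C) \<and> (\<exists>s\<ge>m. ?\<chi> s \<notin> C)"
    if t: "C = cell (?\<chi> t)" "regular X C" for t m C
  proof
    have cellC: "cell z = C" if "z \<in> C" for z
      using cell_cong[of "?\<chi> t" z] that t \<open>\<And>t. ?\<chi> t \<in> topspace X\<close> by simp
    \<comment> \<open>The cell \<open>C\<close> may come from the other half of the splice. If
      \<phi> never meets \<open>C\<close>, the past avoids it altogether; otherwise \<phi> leaves
      \<open>C\<close> at arbitrarily early times.\<close>
    show "\<exists>s\<le>m. ?\<chi> s \<notin> C"
    proof (cases "\<exists>u. \<phi> u \<in> C")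
      case True
      then obtain u where "cell (\<phi> u) = C"
        using cellC by blast
      then obtain s where "s \<le> min m (-1)" "\<phi> s \<notin> C"
        using \<phi> t(2) unfolding ess_full_solution_def essential_def by metis
      then show ?thesis
        by (intro exI[of _ "s - 1"]) (auto simp: splice_def)
    next
      case False
      then show ?thesis
        by (intro exI[of _ "min m (-1)"]) (auto simp: splice_def)
    qed
    show "\<exists>s\<ge>m. ?\<chi> s \<notin> C"
    proof (cases "\<exists>u. \<psi> u \<in> C")
      case True
      then obtain u where "cell (\<psi> u) = C"
        using cellC by blast
      then obtain s where "s \<ge> max m 0" "\<psi> s \<notin> C"
        using \<psi> t(2) unfolding ess_full_solution_def essential_def by metis
      then show ?thesis
        by (intro exI[of _ s]) (auto simp: splice_def)
    next
      case False
      then show ?thesis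
        by (intro exI[of _ "max m 0"]) (auto simp: splice_def)
    qed
  qed
  ultimately show ?thesis
    unfolding ess_full_solution_def full_solution_def essential_def by blast
qed

text \<open>No cell contains both \<open>x\<close> and \<open>y\<close>, so whichever cell is at
  stake, one of the two lies outside it and recurs in both time directions.\<close>

lemma ess_of_uim:
  assumes \<phi>: "full_solution X V A \<phi>" "A \<subseteq> topspace X"
    and xy: "{x, y} \<subseteq> uim_minus \<phi>" "{x, y} \<subseteq> uim_plus \<phi>" "y \<notin> cell x"
  shows "ess_full_solution X V A \<phi>"
  unfolding ess_full_solution_def essential_def
proof (intro conjI allI impI)
  fix t m
  have "\<phi> t \<in> topspace X"
    using \<phi> by (auto simp: full_solution_def)
  then obtain z where z: "z \<in> {x, y}" "z \<notin> cell (\<phi> t)"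
    using cell_cong[of "\<phi> t" x] xy(3) by blast
  have "z \<in> uim_minus \<phi>" "z \<in> uim_plus \<phi>"
    using z(1) xy by auto
  then obtain s s' where "s \<le> m" "\<phi> s = z" "s' \<ge> m" "\<phi> s' = z"
    unfolding mem_uim_minus mem_uim_plus by metis
  then show "\<exists>s\<le>m. \<phi> s \<notin> cell (\<phi> t)" "\<exists>s\<ge>m. \<phi> s \<notin> cell (\<phi> t)"
    using z(2) by auto
qed (use \<phi> in simp)

text \<open>A path from \<open>x\<close> to \<open>y\<close> followed by one back is a cycle;
  repeated periodically it keeps visiting two different cells.\<close>

lemma periodic_solution:
  assumes G: "G \<subseteq> topspace X" and R: "R = {(u, v). u \<in> G \<and> v \<in> G \<and> v \<in> Pi_pt X V u}"
    and xy: "(x, y) \<in> R\<^sup>*" "(y, x) \<in> R\<^sup>*" "y \<notin> cell x" "x \<in> G"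
  shows "\<exists>\<phi>. ess_full_solution X V G \<phi>"
proof -
  \<comment> \<open>This makes both paths nontrivial, hence the period positive.\<close>
  have "x \<noteq> y"
    using xy G cell by auto
  obtain k l where kl: "(x, y) \<in> R ^^ k" "(y, x) \<in> R ^^ l"
    using xy rtrancl_imp_relpow by metis
  obtain f where f: "f 0 = x" "f k = y" "\<And>i. i < k \<Longrightarrow> (f i, f (Suc i)) \<in> R"
    using kl(1) by (auto simp: relpow_fun_conv)
  obtain g where g: "g 0 = y" "g l = x" "\<And>i. i < l \<Longrightarrow> (g i, g (Suc i)) \<in> R"
    using kl(2) by (auto simp: relpow_fun_conv)
  define h where "h i = (if i < k then f i else g (i - k))" for i
  define N where "N = k + l"
  have pos: "k > 0" "l > 0" "N > 0"
    using f g \<open>x \<noteq> y\<close> by (auto simp: N_def intro: gr0I)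
  have h: "h 0 = x" "h k = y" "h N = x"
    using pos f g by (auto simp: h_def N_def)
  have hR: "(h i, h (Suc i)) \<in> R" if "i < N" for i
  proof -
    consider "Suc i < k" | "Suc i = k" | "i \<ge> k" by linarith
    then show ?thesis
    proof cases
      case 1
      then show ?thesis using f(3)[of i] by (simp add: h_def)
    next
      case 2
      then show ?thesis using f(2) f(3)[of i] g(1) by (simp add: h_def)
    next
      case 3
      then show ?thesis using g(3)[of "i - k"] that by (simp add: h_def N_def Suc_diff_le)
    qed
  qed
  define \<phi> where "\<phi> t = h (nat (t mod int N))" for t :: int
  have "\<phi> t \<in> G \<and> \<phi> (t + 1) \<in> Pi_pt X V (\<phi> t)" for t
  proof -
    define i where "i = nat (t mod int N)"
    have i: "i < N" "int i = t mod int N"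
      using pos by (auto simp: i_def nat_less_iff)
    have "\<phi> (t + 1) = h (Suc i)"
    proof (cases "Suc i = N")
      case True
      have "(t + 1) mod int N = (int i + 1) mod int N"
        unfolding i(2) by (simp add: mod_add_left_eq)
      also have "int i + 1 = int N"
        using True by simp
      finally have "(t + 1) mod int N = 0"
        by simp
      then show ?thesis
        using True h by (simp add: \<phi>_def)
    next
      case False
      have "(t + 1) mod int N = (int i + 1) mod int N"
        unfolding i(2) by (simp add: mod_add_left_eq)
      also have "\<dots> = int i + 1"
        using False i by (intro mod_pos_pos_trivial) auto
      finally show ?thesis
        by (simp add: \<phi>_def nat_add_distrib)
    qed
    moreover have "\<phi> t = h i"
      by (simp add: \<phi>_def i_def)
    ultimately show ?thesis
      using hR[OF i(1)] R by auto
  qed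
  then have full: "full_solution X V G \<phi>"
    by (simp add: full_solution_def)
  have per: "\<phi> (int j + int N * m) = h j" if "j < N" for j m
    using that by (simp add: \<phi>_def)
  have visit: "h j \<in> uim_minus \<phi>" "h j \<in> uim_plus \<phi>" if "j < N" for j
  proof -
    \<comment> \<open>As many periods as the absolute value of \<open>m\<close> lead past
      \<open>m\<close> in the future; in the past one further period absorbs the offset
      \<open>j\<close>.\<close>
    have "int j + int N * (- \<bar>m\<bar> - 1) \<le> m" "int j + int N * \<bar>m\<bar> \<ge> m" for m
    proof -
      have "\<bar>m\<bar> \<le> int N * \<bar>m\<bar>"
        using mult_right_mono[of 1 "int N" "\<bar>m\<bar>"] pos by auto
      moreover have "int j \<le> int N"
        using that by simp
      ultimately show "int j + int N * (- \<bar>m\<bar> - 1) \<le> m" "int j + int N * \<bar>m\<bar> \<ge> m"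
        by (auto simp: algebra_simps)
    qed
    then show "h j \<in> uim_minus \<phi>" "h j \<in> uim_plus \<phi>"
      unfolding mem_uim_minus mem_uim_plus using per[OF that] by blast+
  qed
  have "{x, y} \<subseteq> uim_minus \<phi>" "{x, y} \<subseteq> uim_plus \<phi>"
    using visit[of 0] visit[of k] h pos by (auto simp: N_def)
  then show ?thesis
    using ess_of_uim[OF full G _ _ xy(3)] by blast
qed

lemma constant_solution:
  assumes "x \<in> G" "G \<subseteq> topspace X" "\<not> regular X (cell x)"
  shows "ess_full_solution X V G (\<lambda>_. x)"
  using assms Pi_refl by (auto simp: ess_full_solution_def full_solution_def essential_def)

text \<open>A point whose set of predecessors inside \<open>K1 - K0\<close> is smallest lies in a multivector that no other multivector of
  \<open>K1 - K0\<close> flows into, since a return path would produce an essential periodic solution.\<close>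

lemma acyclic_pair_of_no_solution:
  assumes "Pi_closed K1" "Pi_closed K0" "K0 \<subseteq> K1" "\<nexists>\<phi>. ess_full_solution X V (K1 - K0) \<phi>"
  shows "acyclic_pair X K1 K0"
  using assms
proof (induction "card (K1 - K0)" arbitrary: K1 rule: less_induct)
  case less
  note K1 = Pi_closed_sub[OF less.prems(1)]
  let ?G = "K1 - K0"
  have G: "?G \<subseteq> topspace X" "finite ?G"
    using K1 finite_subset[OF _ fin] by auto
  show ?case
  proof (cases "?G = {}")
    case True
    then have "K1 = K0"
      using less.prems by auto
    then show ?thesis
      using trivial_relative_homology_group_topspace[of _ "subtopology X K1"] K1
      by (simp add: acyclic_pair_def Int_absorb1)
  next
    case False
    define R where "R = {(u, v). u \<in> ?G \<and> v \<in> ?G \<and> v \<in> Pi_pt X V u}"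
    define pred where "pred v = {u \<in> ?G. (u, v) \<in> R\<^sup>*}" for v
    obtain x where x: "x \<in> ?G" and xmin: "\<And>y. y \<in> ?G \<Longrightarrow> card (pred x) \<le> card (pred y)"
      using False ex_min_if_finite[of "(\<lambda>v. card (pred v)) ` ?G"] G(2)
      by (metis (no_types, lifting) arg_min_least arg_min_if_finite(1))
    let ?W = "cell x"
    have xX: "x \<in> topspace X"
      using x G by auto
    have W: "?W \<subseteq> ?G"
    proof
      fix w assume w: "w \<in> ?W"
      then have "x \<in> cell w"
        using cell_cong[OF xX w] cell(2)[OF xX] by simp
      then show "w \<in> ?G"
        using w x Pi_closed_cell[OF less.prems(1), of x] Pi_closed_cell[OF less.prems(2), of w] by blast
    qed
    have closed: "Pi_closed (K1 - ?W)"
      unfolding Pi_closed_def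
    proof (intro conjI ballI subsetI)
      fix y z assume y: "y \<in> K1 - ?W" and z: "z \<in> Pi_pt X V y"
      have "z \<notin> ?W"
      proof
        assume zW: "z \<in> ?W"
        have yG: "y \<in> ?G"
          using y z zW W Pi_closedD[OF less.prems(2)] by blast
        have zG: "z \<in> ?G"
          using zW W by blast
        have "x \<in> Pi_pt X V z"
          using cell_cong[OF xX zW] cell(2)[OF xX] by (simp add: Pi_pt_def)
        then have yx: "(y, x) \<in> R\<^sup>*"
          using yG zG z x by (intro converse_rtrancl_into_rtrancl[of y z]) (auto simp: R_def)
        then have "pred y \<subseteq> pred x"
          by (auto simp: pred_def intro: rtrancl_trans)
        moreover have "finite (pred x)"
          using G(2) by (rule rev_finite_subset) (auto simp: pred_def)
        \<comment> \<open>Minimality turns the inclusion into an equality. As \<open>x\<close> is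
          its own predecessor, it is then a predecessor of \<open>y\<close>, which is the return
          path.\<close>
        ultimately have "pred y = pred x"
          using xmin[OF yG] card_seteq by blast
        then have "x \<in> pred y"
          using x by (simp add: pred_def)
        then have "(x, y) \<in> R\<^sup>*"
          by (simp add: pred_def)
        then have "\<exists>\<phi>. ess_full_solution X V ?G \<phi>"
          using periodic_solution[OF G(1) R_def _ yx] y x by blast
        then show False
          using less.prems(4) by blast
      qed
      then show "z \<in> K1 - ?W"
        using y z Pi_closedD[OF less.prems(1)] by blast
    qed (use K1 in auto)
    \<comment> \<open>In a critical cell, resting at \<open>x\<close> forever would be an essential
      solution.\<close>
    have "regular X ?W"
      using constant_solution[OF x G(1)] less.prems(4) by blast
    moreover have "relative_homology_group p (subtopology X (mcl X ?W)) (mouth X ?W)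
        \<cong> relative_homology_group p (subtopology X K1) (K1 - ?W)" for p
    proof -
      have "K1 - (K1 - ?W) = ?W"
        using W by auto
      then show ?thesis
        using homology_closed_difference[OF fin closedin_Pi_closed[OF less.prems(1)] closedin_Pi_closed[OF closed], of p]
        by auto
    qed
    ultimately have "acyclic_pair X K1 (K1 - ?W)"
      unfolding acyclic_pair_def regular_def critical_def
      using isomorphic_group_triviality1 group_relative_homology_group by blast
    moreover have "acyclic_pair X (K1 - ?W) K0"
    proof (rule less.hyps)
      have "x \<in> ?G" "x \<notin> K1 - ?W - K0"
        using x cell(2)[OF xX] by auto
      then show "card (K1 - ?W - K0) < card ?G"
        using G(2) by (intro psubset_card_mono) auto
      show "\<nexists>\<phi>. ess_full_solution X V (K1 - ?W - K0) \<phi>"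
        using less.prems(4) ess_mono[of "K1 - ?W - K0" _ ?G] by blast
    qed (use closed less.prems W in auto)
    ultimately show ?thesis
      using W less.prems(3) by (intro acyclic_pair_trans[of K0 "K1 - ?W" K1]) auto
  qed
qed

section \<open>The field induced on a forward invariant set\<close>

lemma induced_cell:
  assumes "Pi_closed A" "x \<in> A" shows "mvcell (induced V A) x = cell x"
proof -
  have xX: "x \<in> topspace X"
    using assms Pi_closed_sub by blast
  show ?thesis
    unfolding mvcell_def[of "induced V A"]
  proof (rule the_equality)
    show "cell x \<in> induced V A \<and> x \<in> cell x"
      using cell[OF xX] Pi_closed_cell[OF assms] by (simp add: induced_def)
    show "W = cell x" if "W \<in> induced V A \<and> x \<in> W" for W
      using that cell_eqI[of W x] by (simp add: induced_def)
  qed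
qed

lemma induced_mcl:
  assumes "Pi_closed A" "S \<subseteq> A" shows "mcl (subtopology X A) S = mcl X S"
proof -
  have "X closure_of S \<subseteq> A"
    using closure_of_minimal[OF assms(2) closedin_Pi_closed[OF assms(1)]] .
  then show ?thesis
    using assms(2) by (auto simp: mcl_def closure_of_subtopology Int_absorb1)
qed

lemma induced_Pi_pt:
  assumes "Pi_closed A" "x \<in> A" shows "Pi_pt (subtopology X A) (induced V A) x = Pi_pt X V x"
  using assms by (simp add: Pi_pt_def induced_cell induced_mcl)

lemma induced_regular:
  assumes "Pi_closed A" "W \<subseteq> A" shows "regular (subtopology X A) W \<longleftrightarrow> regular X W"
proof -
  have "mcl X W \<subseteq> A"
    using closure_of_minimal[OF assms(2) closedin_Pi_closed[OF assms(1)]] by (simp add: mcl_def)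
  then show ?thesis
    using assms by (simp add: regular_def critical_def mouth_def induced_mcl subtopology_subtopology Int_absorb1)
qed

text \<open>A forward invariant set is closed and a union of cells, so cells, point closures and
  regularity within it are the same as in \<open>X\<close>.\<close>

lemma induced_ess:
  assumes A: "Pi_closed A" and B: "B \<subseteq> A"
  shows "ess_full_solution (subtopology X A) (induced V A) B \<phi> \<longleftrightarrow> ess_full_solution X V B \<phi>"
proof (cases "\<forall>t. \<phi> t \<in> B")
  case True
  then have "\<phi> t \<in> A" for t
    using B by blast
  then show ?thesis
    using True A
    by (simp add: ess_full_solution_def full_solution_def essential_def induced_Pi_pt induced_cell induced_regular Pi_closed_cell)
qed (auto simp: ess_full_solution_def full_solution_def)

lemma induced_Inv:
  assumes "Pi_closed A" "B \<subseteq> A" shows "Inv (subtopology X A) (induced V A) B = Inv X V B"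
  using induced_ess[OF assms] by (simp add: Inv_def)

lemma induced_attractor:
  assumes A: "Pi_closed A" and B: "Pi_closed B" "B \<subseteq> A" and inv: "invariant X V B"
  shows "attractor (subtopology X A) (induced V A) B"
  unfolding attractor_def
proof
  show "invariant (subtopology X A) (induced V A) B"
    using inv A B by (simp add: invariant_def induced_Inv)
  have "Pi_set (subtopology X A) (induced V A) B = (\<Union>x\<in>B. Pi_pt X V x)"
    unfolding Pi_set_def using induced_Pi_pt[OF A] B(2) by (intro SUP_cong) auto
  also have "\<dots> = B"
    using B(1) Pi_refl by (auto simp: Pi_closed_def)
  finally show "Pi_set (subtopology X A) (induced V A) B = B" .
qed

end

section \<open>Morse decompositions\<close>

locale morse_mvf = finite_mvf +
  fixes n :: nat and M :: "nat \<Rightarrow> 'a set"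
  assumes inv: "invariant X V (topspace X)" and morse: "morse_decomposition X V n M"
begin

abbreviation att :: "nat \<Rightarrow> 'a set" where "att \<equiv> Aset X V M"

lemma M_sub: "p \<in> {1..n} \<Longrightarrow> M p \<subseteq> topspace X"
  using morse by (auto simp: morse_decomposition_def)

lemma M_compat: "p \<in> {1..n} \<Longrightarrow> compat_lc (M p)"
  using morse by (auto simp: morse_decomposition_def intro: compat_lc_isolated)

lemma M_disj: "p \<in> {1..n} \<Longrightarrow> q \<in> {1..n} \<Longrightarrow> x \<in> M p \<Longrightarrow> x \<in> M q \<Longrightarrow> p = q"
  using morse unfolding morse_decomposition_def by blast

lemma ess_through: "x \<in> topspace X \<Longrightarrow> \<exists>\<phi>. ess \<phi> \<and> \<phi> 0 = x"
  using inv by (auto simp: invariant_def Inv_def set_eq_iff)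

lemma M_ess:
  assumes "p \<in> {1..n}" "x \<in> M p"
  obtains \<phi> where "ess \<phi>" "\<phi> 0 = x" "range \<phi> \<subseteq> M p"
proof -
  have "M p = Inv X V (M p)"
    using morse assms by (auto simp: morse_decomposition_def isolated_invariant_def invariant_def)
  then obtain \<phi> where \<phi>: "ess_full_solution X V (M p) \<phi>" "\<phi> 0 = x"
    using assms unfolding Inv_def by blast
  moreover have "range \<phi> \<subseteq> M p"
    using \<phi>(1) by (auto simp: ess_full_solution_def full_solution_def)
  ultimately show ?thesis
    using that ess_mono M_sub assms by blast
qed

text \<open>Merges the two alternatives of a Morse decomposition, with ultimate images in place of
  hulls; the first alternative appears as \<open>a = b\<close>.\<close>

lemma limits:
  assumes "ess \<phi>"
  obtains a b where "a \<in> {1..n}" "b \<in> {1..n}" "b \<le> a" "uim_minus \<phi> \<subseteq> M a" "uim_plus \<phi> \<subseteq> M b"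
    "a = b \<longrightarrow> range \<phi> \<subseteq> M a"
proof -
  have "(\<exists>r\<in>{1..n}. range \<phi> \<subseteq> M r) \<or>
      (\<exists>p\<in>{1..n}. \<exists>q\<in>{1..n}. p < q \<and> alpha_lim X V \<phi> \<subseteq> M q \<and> omega_lim X V \<phi> \<subseteq> M p)"
    using morse assms by (simp add: morse_decomposition_def)
  then show ?thesis
  proof (elim disjE bexE conjE)
    fix r assume "r \<in> {1..n}" "range \<phi> \<subseteq> M r"
    then show ?thesis
      using that[of r r] uim_subset_range[of \<phi>] by auto
  next
    fix p q assume "p \<in> {1..n}" "q \<in> {1..n}" "p < q" "alpha_lim X V \<phi> \<subseteq> M q" "omega_lim X V \<phi> \<subseteq> M p"
    then show ?thesis
      using that[of q p] alpha_lim_subset omega_lim_subset M_compat by auto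
  qed
qed

text \<open>Ultimate images are nonempty and Morse sets disjoint, so the indices supplied by
  \<open>limits\<close> are the given ones.\<close>

lemma limits_le:
  assumes "ess \<phi>" "a \<in> {1..n}" "b \<in> {1..n}" "uim_minus \<phi> \<subseteq> M a" "uim_plus \<phi> \<subseteq> M b"
  shows "b \<le> a" "a = b \<Longrightarrow> range \<phi> \<subseteq> M a"
proof -
  obtain a' b' where ab: "a' \<in> {1..n}" "b' \<in> {1..n}" "b' \<le> a'" "uim_minus \<phi> \<subseteq> M a'" "uim_plus \<phi> \<subseteq> M b'"
    "a' = b' \<longrightarrow> range \<phi> \<subseteq> M a'"
    by (rule limits[OF assms(1)])
  then have "a' = a" "b' = b"
    using ess_uim_nonempty[OF assms(1)] assms M_disj by blast+
  then show "b \<le> a" "a = b \<Longrightarrow> range \<phi> \<subseteq> M a"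
    using ab by auto
qed

section \<open>The filtration by attractors\<close>

text \<open>Only the past is constrained: the forward index never exceeds the backward one and so is
  at most \<open>i\<close> automatically. Membership therefore survives any change of the future,
  which is what makes splicing effective.\<close>

lemma mem_att:
  assumes "i \<le> n"
  shows "x \<in> att i \<longleftrightarrow> (\<exists>\<phi> a. ess \<phi> \<and> \<phi> 0 = x \<and> a \<in> {1..i} \<and> uim_minus \<phi> \<subseteq> M a)"
proof
  assume "x \<in> att i"
  then obtain a b where ab: "a \<in> {1..i}" "b \<in> {1..i}" "x \<in> connection X V (M a) (M b)"
    by (auto simp: Aset_def MI_def split: if_splits)
  then show "\<exists>\<phi> a. ess \<phi> \<and> \<phi> 0 = x \<and> a \<in> {1..i} \<and> uim_minus \<phi> \<subseteq> M a"
    using alpha_lim_subset[OF M_compat, of a] assms by (auto simp: connection_def)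
next
  assume "\<exists>\<phi> a. ess \<phi> \<and> \<phi> 0 = x \<and> a \<in> {1..i} \<and> uim_minus \<phi> \<subseteq> M a"
  then obtain \<phi> a where \<phi>: "ess \<phi>" "\<phi> 0 = x" "a \<in> {1..i}" "uim_minus \<phi> \<subseteq> M a"
    by blast
  obtain a' b where ab: "b \<in> {1..n}" "uim_plus \<phi> \<subseteq> M b"
    using limits[OF \<phi>(1)] by metis
  have a: "a \<in> {1..n}"
    using \<phi> assms by auto
  have "b \<le> a"
    using limits_le(1)[OF \<phi>(1) a ab(1) \<phi>(4) ab(2)] .
  then have b: "b \<in> {1..i}"
    using ab \<phi> by auto
  have "x \<in> connection X V (M a) (M b)"
    unfolding connection_def
    using \<phi> ab a alpha_lim_subset[OF M_compat[OF a]] omega_lim_subset[OF M_compat[OF ab(1)]] ess_in[OF \<phi>(1), of 0]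
    by auto
  then have "x \<in> MI X V M {1..i}"
    unfolding MI_def using \<phi>(3) b by blast
  then show "x \<in> att i"
    using \<phi>(3) by (simp add: Aset_def)
qed

lemma att_0: "att 0 = {}"
  by (simp add: Aset_def)

lemma att_sub:
  assumes "i \<le> n" shows "att i \<subseteq> topspace X"
proof
  fix x assume "x \<in> att i"
  then obtain \<phi> where "ess \<phi>" "\<phi> 0 = x"
    using mem_att[OF assms] by blast
  then show "x \<in> topspace X"
    using ess_in by blast
qed

lemma att_n: "att n = topspace X"
proof
  show "att n \<subseteq> topspace X"
    by (rule att_sub) simp
  show "topspace X \<subseteq> att n"
  proof
    fix x assume "x \<in> topspace X"
    then obtain \<phi> where \<phi>: "ess \<phi>" "\<phi> 0 = x"
      using ess_through by blast
    obtain a where "a \<in> {1..n}" "uim_minus \<phi> \<subseteq> M a"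
      by (rule limits[OF \<phi>(1)])
    then show "x \<in> att n"
      using mem_att[OF order_refl] \<phi> by blast
  qed
qed

lemma att_mono:
  assumes "i \<le> j" "j \<le> n" shows "att i \<subseteq> att j"
proof
  fix x assume "x \<in> att i"
  then obtain \<phi> a where \<phi>: "ess \<phi>" "\<phi> 0 = x" "a \<in> {1..i}" "uim_minus \<phi> \<subseteq> M a"
    using mem_att[of i] assms by auto
  then have "a \<in> {1..j}"
    using assms by auto
  then show "x \<in> att j"
    using mem_att[OF assms(2)] \<phi> by blast
qed

lemma Pi_closed_att:
  assumes "i \<le> n" shows "Pi_closed (att i)"
  unfolding Pi_closed_def
proof (intro conjI ballI subsetI)
  show "x \<in> topspace X" if "x \<in> att i" for x
    using that att_sub[OF assms] by blast
next
  fix x y assume x: "x \<in> att i" and y: "y \<in> Pi_pt X V x"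
  obtain \<phi> a where \<phi>: "ess \<phi>" "\<phi> 0 = x" "a \<in> {1..i}" "uim_minus \<phi> \<subseteq> M a"
    using x mem_att[OF assms] by blast
  have "y \<in> topspace X"
    using Pi_sub ess_in[OF \<phi>(1), of 0] \<phi>(2) y by blast
  then obtain \<psi> where \<psi>: "ess \<psi>" "\<psi> 0 = y"
    using ess_through by blast
  have "ess (splice \<phi> \<psi>)" "splice \<phi> \<psi> 0 = y"
    using ess_splice[OF \<phi>(1) \<psi>(1)] \<phi> \<psi> y by (auto simp: splice_def)
  moreover have "uim_minus (splice \<phi> \<psi>) \<subseteq> M a"
    using \<phi> by (simp add: uim_minus_splice)
  ultimately show "y \<in> att i"
    unfolding mem_att[OF assms] using \<phi>(3) by (intro exI[of _ "splice \<phi> \<psi>"] exI[of _ a]) simp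
qed

lemma att_range:
  assumes "i \<le> n" "ess \<phi>" "a \<in> {1..i}" "uim_minus \<phi> \<subseteq> M a"
  shows "\<phi> t \<in> att i"
proof -
  have "ess (\<lambda>s. \<phi> (s + t))" "uim_minus (\<lambda>s. \<phi> (s + t)) \<subseteq> M a"
    using ess_shift[OF assms(2)] assms(4) uim_shift(1)[of \<phi> t] by auto
  moreover have "(\<lambda>s. \<phi> (s + t)) 0 = \<phi> t"
    by simp
  ultimately show ?thesis
    using mem_att[OF assms(1)] assms(3) by blast
qed

lemma att_ess:
  assumes "i \<le> n" "x \<in> att i"
  obtains \<phi> where "ess \<phi>" "\<phi> 0 = x" "range \<phi> \<subseteq> att i"
proof -
  obtain \<phi> a where \<phi>: "ess \<phi>" "\<phi> 0 = x" "a \<in> {1..i}" "uim_minus \<phi> \<subseteq> M a"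
    using assms(2) mem_att[OF assms(1)] by blast
  then have "range \<phi> \<subseteq> att i"
    using att_range[OF assms(1)] by blast
  then show ?thesis
    using that \<phi> by blast
qed

lemma M_sub_att:
  assumes "i \<in> {1..n}" shows "M i \<subseteq> att i"
proof
  fix x assume "x \<in> M i"
  then obtain \<phi> where \<phi>: "ess \<phi>" "\<phi> 0 = x" "range \<phi> \<subseteq> M i"
    using M_ess[OF assms] by blast
  then have "uim_minus \<phi> \<subseteq> M i"
    using uim_subset_range(1)[of \<phi>] by blast
  moreover have "i \<le> n" "i \<in> {1..i}"
    using assms by auto
  ultimately show "x \<in> att i"
    using mem_att \<phi> by blast
qed

text \<open>The past of \<open>x\<close> spliced with a solution in \<open>M i\<close> leads from an
  index \<open>a \<le> j \<le> i\<close> to \<open>i\<close>. Indices cannot rise, so all three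
  coincide and the whole solution stays in \<open>M i\<close>. The case \<open>j < i\<close> gives
  disjointness; \<open>j = i\<close> gives the forward invariance of \<open>att i - M i\<close> and
  the repeller property.\<close>

lemma M_att_backward:
  assumes i: "i \<in> {1..n}" and x: "j \<le> i" "x \<in> att j" and y: "y \<in> Pi_pt X V x" "y \<in> M i"
  shows "i = j \<and> x \<in> M i"
proof -
  have j: "j \<le> n"
    using x i by auto
  obtain \<phi> a where \<phi>: "ess \<phi>" "\<phi> 0 = x" "a \<in> {1..j}" "uim_minus \<phi> \<subseteq> M a"
    using x mem_att[OF j] by blast
  obtain \<psi> where \<psi>: "ess \<psi>" "\<psi> 0 = y" "range \<psi> \<subseteq> M i"
    using M_ess[OF i y(2)] .
  have \<chi>: "ess (splice \<phi> \<psi>)"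
    using ess_splice[OF \<phi>(1) \<psi>(1)] \<phi> \<psi> y by auto
  have a: "a \<in> {1..n}"
    using \<phi> j by auto
  have lim: "uim_minus (splice \<phi> \<psi>) \<subseteq> M a" "uim_plus (splice \<phi> \<psi>) \<subseteq> M i"
    using \<phi> \<psi> uim_subset_range(2)[of \<psi>] by (auto simp: uim_minus_splice uim_plus_splice)
  have "i \<le> a"
    using limits_le(1)[OF \<chi> a i lim] .
  then have eq: "a = i" "i = j"
    using \<phi> x by auto
  \<comment> \<open>Time -1 is where the splice passes through \<open>x\<close>.\<close>
  then have "splice \<phi> \<psi> (-1) \<in> M i"
    using limits_le(2)[OF \<chi> a i lim] by blast
  then show ?thesis
    using eq \<phi> by (simp add: splice_def)
qed

lemma M_att_disj:
  assumes "i \<in> {1..n}" "j < i" shows "M i \<inter> att j = {}"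
proof (rule ccontr)
  assume "M i \<inter> att j \<noteq> {}"
  then obtain x where "x \<in> M i" "x \<in> att j" by blast
  then show False
    using M_att_backward[of i j x x] Pi_refl M_sub assms by fastforce
qed

text \<open>If a Morse set \<open>M c\<close> meets the solution, then \<open>c > i\<close> is
  excluded because that \<open>M c\<close> misses \<open>att i\<close>, and \<open>c < i\<close>
  because that \<open>M c\<close> lies in \<open>att (i - 1)\<close>. Both limit indices are thus
  \<open>i\<close>, and a solution with equal limit indices stays in its Morse set.\<close>

lemma ess_in_M:
  assumes i: "i \<in> {1..n}" and \<phi>: "ess \<phi>" "range \<phi> \<subseteq> att i - att (i - 1)"
  shows "range \<phi> \<subseteq> M i"
proof -
  obtain a b where ab: "a \<in> {1..n}" "b \<in> {1..n}" "uim_minus \<phi> \<subseteq> M a" "uim_plus \<phi> \<subseteq> M b"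
    "a = b \<longrightarrow> range \<phi> \<subseteq> M a"
    using limits[OF \<phi>(1)] by metis
  have eq: "c = i" if c: "c \<in> {1..n}" "y \<in> M c" "y \<in> range \<phi>" for c y
  proof (rule ccontr)
    assume "c \<noteq> i"
    then consider "i < c" | "c \<le> i - 1" by linarith
    then show False
    proof cases
      case 1
      then show ?thesis
        using M_att_disj[of c i] c \<phi>(2) by blast
    next
      case 2
      then show ?thesis
        using M_sub_att[of c] att_mono[of c "i - 1"] c i \<phi>(2) by fastforce
    qed
  qed
  obtain y z where yz: "y \<in> uim_minus \<phi>" "z \<in> uim_plus \<phi>"
    using ess_uim_nonempty[OF \<phi>(1)] by blast
  then have "y \<in> range \<phi>" "z \<in> range \<phi>" "y \<in> M a" "z \<in> M b"
    using uim_subset_range[of \<phi>] ab by blast+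
  then have "a = i" "b = i"
    using eq ab by blast+
  then show ?thesis
    using ab by blast
qed

lemma Pi_closed_att_minus_M:
  assumes i: "i \<in> {1..n}" shows "Pi_closed (att i - M i)"
  unfolding Pi_closed_def
proof (intro conjI ballI subsetI)
  have pc: "Pi_closed (att i)"
    using Pi_closed_att i by auto
  show "x \<in> topspace X" if "x \<in> att i - M i" for x
    using that Pi_closed_sub[OF pc] by auto
  show "y \<in> att i - M i" if "x \<in> att i - M i" "y \<in> Pi_pt X V x" for x y
    using that Pi_closedD[OF pc] M_att_backward[OF i order_refl] by blast
qed

text \<open>Each way of violating the conclusion yields a connection. One is a point of
  \<open>att i\<close> with past in \<open>M i\<close> and forward index below \<open>i\<close>. The
  other is a step out of \<open>M i\<close>: by the first part it enters \<open>att (i - 1)\<close>,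
  where it is continued by a solution inside that set.\<close>

lemma no_connection:
  assumes i: "i \<in> {1..n}" and none: "connection X V (M i) (att (i - 1)) = {}"
  shows "att i = att (i - 1) \<union> M i" "Pi_closed (M i)"
proof -
  have le: "i \<le> n" "i - 1 \<le> n"
    using i by auto
  note compat = compat_lc_Pi_closed[OF Pi_closed_att[OF le(2)]]
  have no: False if "ess \<phi>" "uim_minus \<phi> \<subseteq> M i" "uim_plus \<phi> \<subseteq> att (i - 1)" for \<phi>
  proof -
    have "\<phi> 0 \<in> connection X V (M i) (att (i - 1))"
      unfolding connection_def
      using that alpha_lim_subset[OF M_compat[OF i]] omega_lim_subset[OF compat] ess_in by blast
    then show False
      using none by simp
  qed
  have split: "x \<in> att (i - 1) \<union> M i" if "x \<in> att i" for x
  proof -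
    obtain \<phi> a where \<phi>: "ess \<phi>" "\<phi> 0 = x" "a \<in> {1..i}" "uim_minus \<phi> \<subseteq> M a"
      using mem_att[OF le(1)] \<open>x \<in> att i\<close> by blast
    show ?thesis
    proof (cases "a = i")
      case False
      then have "a \<in> {1..i - 1}"
        using \<phi> by auto
      then show ?thesis
        using mem_att[OF le(2)] \<phi> by blast
    next
      case True
      obtain b where b: "b \<in> {1..n}" "uim_plus \<phi> \<subseteq> M b"
        using limits[OF \<phi>(1)] by metis
      note lim = limits_le[OF \<phi>(1) i b(1) \<phi>(4)[unfolded True] b(2)]
      show ?thesis
      proof (cases "b = i")
        case True
        then show ?thesis
          using lim \<phi> by blast
      next
        case False
        then have "M b \<subseteq> att (i - 1)"
          using M_sub_att[of b] att_mono[of b "i - 1"] b lim le by fastforce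
        then show ?thesis
          using no[OF \<phi>(1)] \<phi>(4) True b by blast
      qed
    qed
  qed
  show eq: "att i = att (i - 1) \<union> M i"
    using split att_mono[of "i - 1" i] M_sub_att[OF i] le by auto
  show "Pi_closed (M i)"
    unfolding Pi_closed_def
  proof (intro conjI ballI subsetI)
    fix x y assume x: "x \<in> M i" and y: "y \<in> Pi_pt X V x"
    show "y \<in> M i"
    proof (rule ccontr)
      assume "y \<notin> M i"
      then have "y \<in> att (i - 1)"
        using Pi_closedD[OF Pi_closed_att[OF le(1)] _ y] M_sub_att[OF i] x eq by blast
      then obtain \<psi> where \<psi>: "ess \<psi>" "\<psi> 0 = y" "range \<psi> \<subseteq> att (i - 1)"
        using att_ess[OF le(2)] by blast
      obtain \<phi> where \<phi>: "ess \<phi>" "\<phi> 0 = x" "range \<phi> \<subseteq> M i"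
        using M_ess[OF i x] .
      have "ess (splice \<phi> \<psi>)"
        using ess_splice[OF \<phi>(1) \<psi>(1)] \<phi> \<psi> y by auto
      moreover have "uim_minus (splice \<phi> \<psi>) \<subseteq> M i" "uim_plus (splice \<phi> \<psi>) \<subseteq> att (i - 1)"
        using uim_subset_range(1)[of \<phi>] uim_subset_range(2)[of \<psi>] \<phi>(3) \<psi>(3)
        unfolding uim_minus_splice uim_plus_splice by blast+
      ultimately show False
        by (rule no)
    qed
  qed (use M_sub[OF i] in auto)
qed

lemma invariant_att:
  assumes "i \<le> n" shows "invariant X V (att i)"
  unfolding invariant_def
proof (rule antisym)
  show "att i \<subseteq> Inv X V (att i)"
  proof
    fix x assume x: "x \<in> att i"
    obtain \<phi> where "ess \<phi>" "\<phi> 0 = x" "range \<phi> \<subseteq> att i"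
      using att_ess[OF assms x] .
    then show "x \<in> Inv X V (att i)"
      using x ess_range[of \<phi>] by (auto simp: Inv_def)
  qed
qed (auto simp: Inv_def)

lemma M_eq_Inv:
  assumes i: "i \<in> {1..n}" shows "Inv X V (att i - att (i - 1)) = M i"
proof (intro antisym subsetI)
  fix x assume "x \<in> Inv X V (att i - att (i - 1))"
  then obtain \<phi> where \<phi>: "ess_full_solution X V (att i - att (i - 1)) \<phi>" "\<phi> 0 = x"
    by (auto simp: Inv_def)
  then have "range \<phi> \<subseteq> att i - att (i - 1)"
    by (auto simp: ess_full_solution_def full_solution_def)
  moreover have "ess \<phi>"
    using ess_mono[OF \<phi>(1)] att_sub[of i] i by auto
  ultimately have "range \<phi> \<subseteq> M i"
    using ess_in_M[OF i] by blast
  then show "x \<in> M i"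
    using \<phi>(2) by blast
next
  fix x assume x: "x \<in> M i"
  obtain \<phi> where \<phi>: "ess \<phi>" "\<phi> 0 = x" "range \<phi> \<subseteq> M i"
    using M_ess[OF i x] .
  have "M i \<subseteq> att i - att (i - 1)"
    using M_sub_att[OF i] M_att_disj[OF i, of "i - 1"] i by auto
  then show "x \<in> Inv X V (att i - att (i - 1))"
    using x \<phi> ess_range[OF \<phi>(1), of "att i - att (i - 1)"] unfolding Inv_def by blast
qed

lemma induced_repeller:
  assumes i: "i \<in> {1..n}" shows "repeller (subtopology X (att i)) (induced V (att i)) (M i)"
  unfolding repeller_def
proof
  have le: "i \<le> n"
    using i by simp
  note A = Pi_closed_att[OF le]
  have "invariant X V (M i)"
    using morse i by (auto simp: morse_decomposition_def isolated_invariant_def)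
  then show "invariant (subtopology X (att i)) (induced V (att i)) (M i)"
    using A M_sub_att[OF i] by (simp add: invariant_def induced_Inv)
  have "x \<in> Pi_inv (subtopology X (att i)) (induced V (att i)) (M i) \<longleftrightarrow> x \<in> M i" for x
  proof
    assume "x \<in> Pi_inv (subtopology X (att i)) (induced V (att i)) (M i)"
    then show "x \<in> M i"
      using M_att_backward[OF i order_refl] by (auto simp: Pi_inv_def induced_Pi_pt[OF A])
  next
    assume x: "x \<in> M i"
    then have "x \<in> att i" "x \<in> Pi_pt X V x" "x \<in> topspace X"
      using M_sub_att[OF i] att_sub[OF le] Pi_refl by blast+
    then show "x \<in> Pi_inv (subtopology X (att i)) (induced V (att i)) (M i)"
      using x unfolding Pi_inv_def by (auto simp: induced_Pi_pt[OF A])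
  qed
  then show "Pi_inv (subtopology X (att i)) (induced V (att i)) (M i) = M i"
    by blast
qed

section \<open>Homology along the filtration and the Morse equation\<close>

lemma homology_att_step:
  assumes i: "i \<in> {1..n}"
  shows "relative_homology_group p (subtopology X (att i)) (att (i - 1))
       \<cong> relative_homology_group p (subtopology X (mcl X (M i))) (mouth X (M i))"
proof -
  have le: "i \<le> n" "i - 1 \<le> n"
    using i by auto
  have sub: "att (i - 1) \<subseteq> att i - M i"
    using att_mono[of "i - 1" i] M_att_disj[OF i, of "i - 1"] i by auto
  \<comment> \<open>By \<open>M_eq_Inv\<close> such a solution would be in \<open>M i\<close> at
    time 0.\<close>
  have "\<nexists>\<phi>. ess_full_solution X V (att i - M i - att (i - 1)) \<phi>"
  proof
    assume "\<exists>\<phi>. ess_full_solution X V (att i - M i - att (i - 1)) \<phi>"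
    then obtain \<phi> where \<phi>: "ess_full_solution X V (att i - M i - att (i - 1)) \<phi>"
      by blast
    then have "\<phi> 0 \<in> Inv X V (att i - att (i - 1))"
      using ess_mono[OF \<phi>, of "att i - att (i - 1)"]
      by (auto simp: Inv_def ess_full_solution_def full_solution_def)
    moreover have "\<phi> 0 \<notin> M i"
      using \<phi> by (auto simp: ess_full_solution_def full_solution_def)
    ultimately show False
      using M_eq_Inv[OF i] by simp
  qed
  then have "acyclic_pair X (att i - M i) (att (i - 1))"
    by (rule acyclic_pair_of_no_solution[OF Pi_closed_att_minus_M[OF i] Pi_closed_att[OF le(2)] sub])
  then have "incl_iso X (att i) (att (i - 1)) (att i) (att i - M i)"
    using sub by (intro incl_iso_relativize) auto
  then have "relative_homology_group p (subtopology X (att i)) (att (i - 1))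
      \<cong> relative_homology_group p (subtopology X (att i)) (att i - M i)"
    by (rule incl_iso_imp_isomorphic)
  moreover have "att i - (att i - M i) = M i"
    using M_sub_att[OF i] by auto
  then have "relative_homology_group p (subtopology X (mcl X (M i))) (mouth X (M i))
      \<cong> relative_homology_group p (subtopology X (att i)) (att i - M i)"
    using homology_closed_difference[OF fin closedin_Pi_closed[OF Pi_closed_att[OF le(1)]]
        closedin_Pi_closed[OF Pi_closed_att_minus_M[OF i]], of p] by auto
  ultimately show ?thesis
    by (meson group.iso_sym group_relative_homology_group iso_trans)
qed

lemma morse_step:
  assumes i: "i \<in> {1..n}"
  obtains q where "poincare X (M i) + poincare X (att (i - 1)) = poincare X (att i) + [:1, 1:] * q"
    "q \<noteq> 0 \<Longrightarrow> connection X V (M i) (att (i - 1)) \<noteq> {}"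
proof -
  have le: "i \<le> n" "i - 1 \<le> n"
    using i by auto
  note cl = closedin_Pi_closed[OF Pi_closed_att[OF le(1)]] closedin_Pi_closed[OF Pi_closed_att[OF le(2)]]
  obtain q where q: "poincare X (M i) + poincare X (att (i - 1)) = poincare X (att i) + [:1, 1:] * q"
    "q \<noteq> 0 \<Longrightarrow> \<exists>p. \<not> inj_on (hom_induced p (subtopology X (att (i - 1))) {} (subtopology X (att i)) {} id)
       (carrier (homology_group p (subtopology X (att (i - 1)))))"
    using poincare_closed_pair[OF fin cl att_mono[of "i - 1" i] homology_att_step[OF i]] le by auto
  have "connection X V (M i) (att (i - 1)) \<noteq> {}" if "q \<noteq> 0"
  proof
    assume "connection X V (M i) (att (i - 1)) = {}"
    then have "att i = att (i - 1) \<union> M i" "closedin X (M i)"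
      using no_connection[OF i] closedin_Pi_closed by auto
    moreover have "att (i - 1) \<inter> M i = {}"
      using M_att_disj[OF i, of "i - 1"] i by auto
    ultimately show False
      using inj_on_hom_induced_clopen[OF cl] q(2)[OF that] by blast
  qed
  then show ?thesis
    using q(1) that by blast
qed

lemma morse_equation:
  "\<exists>q :: nat \<Rightarrow> nat poly.
     (\<Sum>i=1..n. poincare X (M i)) = poincare X (topspace X) + [:1, 1:] * (\<Sum>i=1..n. q i) \<and>
     (\<forall>i\<in>{1..n}. q i \<noteq> 0 \<longrightarrow> connection X V (M i) (att (i - 1)) \<noteq> {})"
proof -
  have "\<forall>i\<in>{1..n}. \<exists>q. poincare X (M i) + poincare X (att (i - 1)) = poincare X (att i) + [:1, 1:] * q
      \<and> (q \<noteq> 0 \<longrightarrow> connection X V (M i) (att (i - 1)) \<noteq> {})"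
    using morse_step by metis
  then obtain q where q: "\<And>i. i \<in> {1..n} \<Longrightarrow>
      poincare X (M i) + poincare X (att (i - 1)) = poincare X (att i) + [:1, 1:] * q i"
    "\<forall>i\<in>{1..n}. q i \<noteq> 0 \<longrightarrow> connection X V (M i) (att (i - 1)) \<noteq> {}"
    by metis
  \<comment> \<open>Partial sums make the telescoping an induction: it starts from the empty
    \<open>att 0\<close>, whose polynomial is 0, and ends at \<open>att n\<close>, which is the
    whole space.\<close>
  have "(\<Sum>i=1..k. poincare X (M i)) = poincare X (att k) + [:1, 1:] * (\<Sum>i=1..k. q i)" if "k \<le> n" for k
    using that
  proof (induction k)
    case 0
    then show ?case
      by (simp add: att_0 poincare_empty)
  next
    case (Suc k)
    have "(\<Sum>i=1..Suc k. poincare X (M i)) = (\<Sum>i=1..k. poincare X (M i)) + poincare X (M (Suc k))"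
      by simp
    also have "\<dots> = (poincare X (M (Suc k)) + poincare X (att k)) + [:1, 1:] * (\<Sum>i=1..k. q i)"
      using Suc by (simp add: ac_simps)
    also have "poincare X (M (Suc k)) + poincare X (att k) = poincare X (att (Suc k)) + [:1, 1:] * q (Suc k)"
      using q(1)[of "Suc k"] Suc.prems by simp
    also have "\<dots> + [:1, 1:] * (\<Sum>i=1..k. q i) = poincare X (att (Suc k)) + [:1, 1:] * (\<Sum>i=1..Suc k. q i)"
    proof -
      have "a + c * b + c * s = a + c * (s + b)" for a b c s :: "nat poly"
        by (simp add: algebra_simps)
      moreover have "(\<Sum>i=1..Suc k. q i) = (\<Sum>i=1..k. q i) + q (Suc k)"
        by simp
      ultimately show ?thesis
        by (simp only:)
    qed
    finally show ?case .
  qed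
  from this[of n] show ?thesis
    using q(2) by (intro exI[of _ q]) (simp add: att_n)
qed

end

theorem theorem7p10:
  fixes X :: "'a topology" and V :: "'a set set" and n :: nat and M :: "nat \<Rightarrow> 'a set"
  assumes "finite (topspace X)" and "t0_space X"
    and "multivector_field X V"
    and "invariant X V (topspace X)"
    and "morse_decomposition X V n M"
  shows "(\<forall>i\<in>{1..n}.
            attractor (subtopology X (Aset X V M i)) (induced V (Aset X V M i)) (Aset X V M (i - 1)) \<and>
            M i = Inv (subtopology X (Aset X V M i)) (induced V (Aset X V M i))
                      (Aset X V M i - Aset X V M (i - 1)) \<and>
            repeller (subtopology X (Aset X V M i)) (induced V (Aset X V M i)) (M i))
       \<and> (\<exists>q :: nat \<Rightarrow> nat poly.
            (\<Sum>i=1..n. poincare X (M i)) = poincare X (topspace X) + [:1, 1:] * (\<Sum>i=1..n. q i) \<and>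
            (\<forall>i\<in>{2..n}. q i \<noteq> 0 \<longrightarrow> connection X V (M i) (Aset X V M (i - 1)) \<noteq> {}))"
proof -
  interpret morse_mvf X V n M
    using assms by unfold_locales
  have "attractor (subtopology X (att i)) (induced V (att i)) (att (i - 1)) \<and>
      M i = Inv (subtopology X (att i)) (induced V (att i)) (att i - att (i - 1)) \<and>
      repeller (subtopology X (att i)) (induced V (att i)) (M i)" if i: "i \<in> {1..n}" for i
  proof (intro conjI)
    have le: "i \<le> n" "i - 1 \<le> n" "i - 1 \<le> i"
      using i by auto
    note A = Pi_closed_att[OF le(1)]
    show "attractor (subtopology X (att i)) (induced V (att i)) (att (i - 1))"
      by (rule induced_attractor[OF A Pi_closed_att[OF le(2)] att_mono[OF le(3,1)] invariant_att[OF le(2)]])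
    show "M i = Inv (subtopology X (att i)) (induced V (att i)) (att i - att (i - 1))"
      using induced_Inv[OF A, of "att i - att (i - 1)"] M_eq_Inv[OF i] by simp
    show "repeller (subtopology X (att i)) (induced V (att i)) (M i)"
      by (rule induced_repeller[OF i])
  qed
  moreover have "{2..n} \<subseteq> {1..n}"
    by auto
  ultimately show ?thesis
    using morse_equation by blast
qed

end
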